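(* Let $\widetilde M=M_1\times M_2$ be a product of two Carnot--Carath\'eodory spaces, and let $w$ be an increasing function with $\sum_{j=0}^\infty j\,w(C_02^{-j})<\infty$, where $C_0$ is any given positive constant. Then there exists a positive constant $C$ such that for every open subset $\Omega$ of $\widetilde M$ with finite measure $$\sum_{R=I_1\times I_2\in\mathcal M_1(\Omega)}\mu(R)\,w\Big(\frac{\mu_2(I_2)}{\mu_2(\widehat I_2)}\Big)\le C\mu(\Omega)$$ and $$\sum_{R=I_1\times I_2\in\mathcal M_2(\Omega)}\mu(R)\,w\Big(\frac{\mu_1(I_1)}{\mu_1(\widehat I_1)}\Big)\le C\mu(\Omega).$$
   Context: **Carnot--Carath\'eodory spaces.** Each $M_i$ ($i=1,2$) is a connected smooth manifold with finitely many smooth real vector fields $X_1,\dots,X_k$ of finite type (they and their iterated commutators up to some finite order span the tangent space at every point). It carries the control metric $d_i$: $d_i(p,q)$ is the infimum of $\delta>0$ for which there is an absolutely continuous $\gamma:[0,1]\to M_i$ from $p$ to $q$ with $\gamma'(t)=\sum_j a_j(t)X_j(\gamma(t))$ and $\sum_j|a_j(t)|^2<\delta^2$ for a.e. $t$. (Model example: the boundary $\{(z,w)\in\mathbb C^2:\Im w=P(z)\}$, $P$ a subharmonic non-harmonic polynomial, with the real and imaginary parts of the tangential $(0,1)$ vector field.) Either $M_i$ is compact with a fixed smooth measure of strictly positive density, or $M_i$ is unbounded with Lebesgue measure; the measure is $\mu_i$ and $\mu=\mu_1\times\mu_2$. With $B(x,r)=\{y:d_i(x,y)<r\}$ one has: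 $\mu_i(B(x,2r))\le C\mu_i(B(x,r))$; hence $\mu_i(B(x,\lambda r))\le C\lambda^{Q_i}\mu_i(B(x,r))$ for $\lambda\ge1$ and some $Q_i>0$; and in the unbounded case $\mu_i(B(x,sr))\ge s^4\mu_i(B(x,r))$ for $s\ge1$. **Dyadic cubes and rectangles.** On each $M_i$ fix a Christ system of open dyadic cubes $\{I^k_\alpha\}_{k\in\mathbb Z,\alpha}$: for each $k$ the $I^k_\alpha$ are disjoint and cover $M_i$ up to a null set; for $l\ge k$ either $I^l_\beta\subset I^k_\alpha$ or they are disjoint; each $I^k_\alpha$ lies in a unique $I^l_\beta$ for each $l<k$; $\mathrm{diam}(I^k_\alpha)\le C_12^{-k}$; and $I_\alpha^k\supset B(z^k_\alpha,C_22^{-k})$ for some $z_\alpha^k\in M_i$. A dyadic rectangle is $R=I_1\times I_2$ with $I_i$ a dyadic cube of $M_i$. For open $\Omega\subset\widetilde M$ of finite measure, $\mathcal M_i(\Omega)$ ($i=1,2$) is the family of dyadic rectangles $R\subset\Omega$ that are maximal in the $i$-th direction (i.e. maximal with respect to enlarging the factor $I_i$ to a larger dyadic cube while the other factor is kept fixed and the rectangle stays in $\Omega$). For $R=I_1\times I_2\in\mathcal M_1(\Omega)$, $\widehat I_2=\widehat I_2(I_1)$ is the biggest dyadic cube of $M_2$ containing $I_2$ with $\mu\big((I_1\times\widehat I_2)\cap\Omega\big)>\frac12\mu(I_1\times\widehat I_2)$. For $R=I_1\times I_2\in\mathcal M_2(\Omega)$, $\widehat I_1=\widehat I_1(I_2)$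 is the biggest dyadic cube of $M_1$ containing $I_1$ with $\mu\big((\widehat I_1\times I_2)\cap\Omega\big)>\frac12\mu(\widehat I_1\times I_2)$. *)

theory Defs
  imports "HOL-Analysis.Analysis"
begin

section \<open>Smooth manifolds\<close>

text \<open>
  A manifold is a whole type \<open>'a\<close> (Hausdorff, second countable) with a maximal smooth atlas.
  A chart is a pair of an open domain and a coordinate map into a Euclidean space \<open>'e\<close>; the
  values of the coordinate map outside the domain are irrelevant.
\<close>

primrec continuously_differentiable_on ::
    "nat \<Rightarrow> 'e::real_normed_vector set \<Rightarrow> ('e \<Rightarrow> 'f::real_normed_vector) \<Rightarrow> bool" where
  "continuously_differentiable_on 0 S f \<longleftrightarrow> continuous_on S f"
| "continuously_differentiable_on (Suc n) S f \<longleftrightarrow>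
     (\<forall>x\<in>S. f differentiable (at x)) \<and>
     (\<forall>v. continuously_differentiable_on n S (\<lambda>x. frechet_derivative f (at x) v))"

text \<open>Only used for open \<open>S\<close>.\<close>

definition smooth_on :: "'e::real_normed_vector set \<Rightarrow> ('e \<Rightarrow> 'f::real_normed_vector) \<Rightarrow> bool" where
  "smooth_on S f \<longleftrightarrow> (\<forall>n. continuously_differentiable_on n S f)"

type_synonym ('a, 'e) chart = "'a set \<times> ('a \<Rightarrow> 'e)"

definition is_chart :: "('a::topological_space, 'e::euclidean_space) chart \<Rightarrow> bool" where
  "is_chart c \<longleftrightarrow> (case c of (U, \<phi>) \<Rightarrow>
     open U \<and> open (\<phi> ` U) \<and> homeomorphism U (\<phi> ` U) \<phi> (inv_into U \<phi>))"

definition smooth_transition ::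
    "('a::topological_space, 'e::euclidean_space) chart \<Rightarrow> ('a, 'e) chart \<Rightarrow> bool" where
  "smooth_transition c c' \<longleftrightarrow> (case c of (U, \<phi>) \<Rightarrow> case c' of (V, \<psi>) \<Rightarrow>
     smooth_on (\<phi> ` (U \<inter> V)) (\<psi> \<circ> inv_into U \<phi>))"

definition smooth_structure ::
    "('a::topological_space, 'e::euclidean_space) chart set \<Rightarrow> bool" where
  "smooth_structure \<A> \<longleftrightarrow>
     (\<forall>c\<in>\<A>. is_chart c) \<and> (\<Union>c\<in>\<A>. fst c) = UNIV \<and>
     (\<forall>c\<in>\<A>. \<forall>c'\<in>\<A>. smooth_transition c c') \<and>
     (\<forall>c. is_chart c \<and> (\<forall>c'\<in>\<A>. smooth_transition c c' \<and> smooth_transition c' c) \<longrightarrow> c \<in> \<A>)"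

definition smooth_function ::
    "('a::topological_space, 'e::euclidean_space) chart set \<Rightarrow> ('a \<Rightarrow> real) \<Rightarrow> bool" where
  "smooth_function \<A> f \<longleftrightarrow> (\<forall>(U, \<phi>)\<in>\<A>. smooth_on (\<phi> ` U) (f \<circ> inv_into U \<phi>))"


section \<open>Vector fields and the control metric\<close>

text \<open>
  Tangent vectors at a point are derivations of the algebra of smooth functions at that point, and
  smooth vector fields are derivations of that algebra. Only the action on smooth functions matters.
\<close>

definition tangent_vector ::
    "('a::topological_space, 'e::euclidean_space) chart set \<Rightarrow> 'a \<Rightarrow> (('a \<Rightarrow> real) \<Rightarrow> real) \<Rightarrow> bool" where
  "tangent_vector \<A> p v \<longleftrightarrow>
     (\<forall>f g a b. smooth_function \<A> f \<longrightarrow> smooth_function \<A> g \<longrightarrow>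
        v (\<lambda>x. a * f x + b * g x) = a * v f + b * v g \<and>
        v (\<lambda>x. f x * g x) = f p * v g + v f * g p)"

type_synonym 'a vector_field = "('a \<Rightarrow> real) \<Rightarrow> 'a \<Rightarrow> real"

definition smooth_vector_field ::
    "('a::topological_space, 'e::euclidean_space) chart set \<Rightarrow> 'a vector_field \<Rightarrow> bool" where
  "smooth_vector_field \<A> X \<longleftrightarrow>
     (\<forall>f. smooth_function \<A> f \<longrightarrow> smooth_function \<A> (X f)) \<and>
     (\<forall>p. tangent_vector \<A> p (\<lambda>f. X f p))"

definition commutator :: "'a vector_field \<Rightarrow> 'a vector_field \<Rightarrow> 'a vector_field" where
  "commutator X Y f = (\<lambda>p. X (Y f) p - Y (X f) p)"

inductive iterated_commutator :: "'a vector_field list \<Rightarrow> nat \<Rightarrow> 'a vector_field \<Rightarrow> bool"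
  for Xs where
  "X \<in> set Xs \<Longrightarrow> iterated_commutator Xs 1 X"
| "iterated_commutator Xs m Y \<Longrightarrow> iterated_commutator Xs n Z \<Longrightarrow>
     iterated_commutator Xs (m + n) (commutator Y Z)"

definition finite_type ::
    "('a::topological_space, 'e::euclidean_space) chart set \<Rightarrow> 'a vector_field list \<Rightarrow> bool" where
  "finite_type \<A> Xs \<longleftrightarrow>
     (\<exists>m. \<forall>p v. tangent_vector \<A> p v \<longrightarrow>
        (\<exists>F c. finite F \<and> (\<forall>Z\<in>F. \<exists>n\<le>m. iterated_commutator Xs n Z) \<and>
           (\<forall>f. smooth_function \<A> f \<longrightarrow> v f = (\<Sum>Z\<in>F. c Z * Z f p))))"

definition absolutely_continuous_fun :: "(real \<Rightarrow> real) \<Rightarrow> bool" where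
  "absolutely_continuous_fun f \<longleftrightarrow>
     (\<forall>\<epsilon>>0. \<exists>\<delta>>0. \<forall>(n::nat) s t.
        (\<forall>i<n. 0 \<le> s i \<and> s i \<le> t i \<and> t i \<le> 1) \<and>
        disjoint_family_on (\<lambda>i. {s i<..<t i}) {..<n} \<and>
        (\<Sum>i<n. t i - s i) < \<delta> \<longrightarrow> (\<Sum>i<n. \<bar>f (t i) - f (s i)\<bar>) < \<epsilon>)"

text \<open>Absolute continuity on \<open>[0,1]\<close>; a curve in a manifold is tested against smooth functions.\<close>

definition absolutely_continuous_curve ::
    "('a::topological_space, 'e::euclidean_space) chart set \<Rightarrow> (real \<Rightarrow> 'a) \<Rightarrow> bool" where
  "absolutely_continuous_curve \<A> \<gamma> \<longleftrightarrow> continuous_on {0..1} \<gamma> \<and>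
     (\<forall>f. smooth_function \<A> f \<longrightarrow> absolutely_continuous_fun (f \<circ> \<gamma>))"

text \<open>
  Read through derivations, the equation \<open>\<gamma>'(t) = \<Sum>\<^sub>j a\<^sub>j(t) X\<^sub>j(\<gamma>(t))\<close> says that
  \<open>(f \<circ> \<gamma>)'(t) = \<Sum>\<^sub>j a\<^sub>j(t) (X\<^sub>j f)(\<gamma>(t))\<close> for all smooth \<open>f\<close>. The exceptional null set of times
  does not depend on \<open>f\<close>.
\<close>

definition admissible_curve ::
    "('a::topological_space, 'e::euclidean_space) chart set \<Rightarrow> 'a vector_field list \<Rightarrow>
      real \<Rightarrow> (real \<Rightarrow> 'a) \<Rightarrow> bool" where
  "admissible_curve \<A> Xs \<delta> \<gamma> \<longleftrightarrow> absolutely_continuous_curve \<A> \<gamma> \<and>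
     (\<exists>a. AE t in lborel. t \<in> {0..1} \<longrightarrow>
        (\<forall>f. smooth_function \<A> f \<longrightarrow>
           ((f \<circ> \<gamma>) has_real_derivative (\<Sum>j<length Xs. a j t * (Xs ! j) f (\<gamma> t))) (at t within {0..1})) \<and>
        (\<Sum>j<length Xs. \<bar>a j t\<bar>\<^sup>2) < \<delta>\<^sup>2)"

text \<open>
  The infimum is taken in \<^typ>\<open>ennreal\<close>, so that it would be \<open>\<infinity>\<close> if no admissible curve existed.
\<close>

definition control_metric ::
    "('a::topological_space, 'e::euclidean_space) chart set \<Rightarrow> 'a vector_field list \<Rightarrow>
      'a \<Rightarrow> 'a \<Rightarrow> ennreal" where
  "control_metric \<A> Xs p q =
     Inf {ennreal \<delta> |\<delta>. \<delta> > 0 \<and> (\<exists>\<gamma>. admissible_curve \<A> Xs \<delta> \<gamma> \<and> \<gamma> 0 = p \<and> \<gamma> 1 = q)}"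

definition mball :: "('a \<Rightarrow> 'a \<Rightarrow> ennreal) \<Rightarrow> 'a \<Rightarrow> real \<Rightarrow> 'a set" where
  "mball d x r = {y. d x y < ennreal r}"


section \<open>Carnot--Caratheodory spaces\<close>

definition smooth_positive_measure ::
    "('a::topological_space, 'e::euclidean_space) chart set \<Rightarrow> 'a measure \<Rightarrow> bool" where
  "smooth_positive_measure \<A> \<mu> \<longleftrightarrow> sets \<mu> = sets borel \<and>
     (\<forall>(U, \<phi>)\<in>\<A>. \<exists>\<rho>::'e \<Rightarrow> real. smooth_on (\<phi> ` U) \<rho> \<and> (\<forall>y\<in>\<phi> ` U. \<rho> y > 0) \<and>
        (\<forall>B\<in>sets borel. B \<subseteq> U \<longrightarrow>
           emeasure \<mu> B = (\<integral>\<^sup>+y\<in>\<phi> ` B. ennreal (\<rho> y) \<partial>lborel)))"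

text \<open>
  Lebesgue measure on \<open>M\<close> refers to a global coordinate system, as for the boundary
  \<open>{(z, w). Im w = P z}\<close> with coordinates \<open>(z, Re w)\<close>.
\<close>

definition lebesgue_in_global_chart ::
    "('a::topological_space, 'e::euclidean_space) chart set \<Rightarrow> 'a measure \<Rightarrow> bool" where
  "lebesgue_in_global_chart \<A> \<mu> \<longleftrightarrow> sets \<mu> = sets borel \<and>
     (\<exists>\<phi>. (UNIV, \<phi>) \<in> \<A> \<and> (\<forall>B\<in>sets borel. emeasure \<mu> B = emeasure lborel (\<phi> ` B)))"

text \<open>
  The usual convention that balls are measurable with positive finite measure is part of doubling.
\<close>

definition doubling :: "('a \<Rightarrow> 'a \<Rightarrow> ennreal) \<Rightarrow> 'a measure \<Rightarrow> bool" where
  "doubling d \<mu> \<longleftrightarrow>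
     (\<forall>x. \<forall>r>0. mball d x r \<in> sets \<mu> \<and> 0 < emeasure \<mu> (mball d x r) \<and> emeasure \<mu> (mball d x r) < \<infinity>) \<and>
     (\<exists>C>0. \<forall>x. \<forall>r>0.
        emeasure \<mu> (mball d x (2 * r)) \<le> ennreal C * emeasure \<mu> (mball d x r))"

definition carnot_caratheodory_space ::
    "('a::{t2_space,second_countable_topology}, 'e::euclidean_space) chart set \<Rightarrow>
      'a vector_field list \<Rightarrow> 'a measure \<Rightarrow> bool" where
  "carnot_caratheodory_space \<A> Xs \<mu> \<longleftrightarrow>
     connected (UNIV :: 'a set) \<and> smooth_structure \<A> \<and>
     (\<forall>X\<in>set Xs. smooth_vector_field \<A> X) \<and> finite_type \<A> Xs \<and>
     doubling (control_metric \<A> Xs) \<mu> \<and>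
     (compact (UNIV :: 'a set) \<and> smooth_positive_measure \<A> \<mu> \<or>
      (\<forall>x r. mball (control_metric \<A> Xs) x r \<noteq> UNIV) \<and> lebesgue_in_global_chart \<A> \<mu> \<and>
      (\<forall>x. \<forall>r>0. \<forall>s\<ge>1.
         emeasure \<mu> (mball (control_metric \<A> Xs) x (s * r)) \<ge>
         ennreal (s ^ 4) * emeasure \<mu> (mball (control_metric \<A> Xs) x r)))"


section \<open>Dyadic cubes and rectangles\<close>

text \<open>
  \<open>D k\<close> is the set of the cubes of generation \<open>k\<close>. They are nonempty and disjoint, so no index
  \<open>\<alpha>\<close> is needed.
\<close>

definition christ_cubes ::
    "('a::topological_space \<Rightarrow> 'a \<Rightarrow> ennreal) \<Rightarrow> 'a measure \<Rightarrow> (int \<Rightarrow> 'a set set) \<Rightarrow> bool" where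
  "christ_cubes d \<mu> D \<longleftrightarrow>
     (\<forall>k. \<forall>I\<in>D k. open I) \<and>
     (\<forall>k. disjoint (D k)) \<and>
     (\<forall>k. UNIV - \<Union>(D k) \<in> null_sets \<mu>) \<and>
     (\<forall>k l. k \<le> l \<longrightarrow> (\<forall>I\<in>D k. \<forall>J\<in>D l. J \<subseteq> I \<or> J \<inter> I = {})) \<and>
     (\<forall>k l. l < k \<longrightarrow> (\<forall>I\<in>D k. \<exists>!J. J \<in> D l \<and> I \<subseteq> J)) \<and>
     (\<exists>C\<^sub>1>0. \<forall>k. \<forall>I\<in>D k. \<forall>x\<in>I. \<forall>y\<in>I. d x y \<le> ennreal (C\<^sub>1 * 2 powi (- k))) \<and>
     (\<exists>C\<^sub>2>0. \<forall>k. \<forall>I\<in>D k. \<exists>z. mball d z (C\<^sub>2 * 2 powi (- k)) \<subseteq> I)"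

text \<open>
  As a set, the same cube may belong to several generations (on a compact space, the whole space
  does); maximality and summation below refer to cubes as sets.
\<close>

definition dyadic_cubes :: "(int \<Rightarrow> 'a set set) \<Rightarrow> 'a set set" where
  "dyadic_cubes D = (\<Union>k. D k)"

text \<open>A dyadic rectangle \<open>I\<^sub>1 \<times> I\<^sub>2\<close> is represented by the pair \<open>(I\<^sub>1, I\<^sub>2)\<close>.\<close>

definition max_rectangles_1 ::
    "(int \<Rightarrow> 'a set set) \<Rightarrow> (int \<Rightarrow> 'b set set) \<Rightarrow> ('a \<times> 'b) set \<Rightarrow> ('a set \<times> 'b set) set" where
  "max_rectangles_1 D\<^sub>1 D\<^sub>2 \<Omega> =
     {(I\<^sub>1, I\<^sub>2). I\<^sub>1 \<in> dyadic_cubes D\<^sub>1 \<and> I\<^sub>2 \<in> dyadic_cubes D\<^sub>2 \<and> I\<^sub>1 \<times> I\<^sub>2 \<subseteq> \<Omega> \<and>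
        (\<forall>J\<in>dyadic_cubes D\<^sub>1. I\<^sub>1 \<subseteq> J \<and> J \<times> I\<^sub>2 \<subseteq> \<Omega> \<longrightarrow> J = I\<^sub>1)}"

definition max_rectangles_2 ::
    "(int \<Rightarrow> 'a set set) \<Rightarrow> (int \<Rightarrow> 'b set set) \<Rightarrow> ('a \<times> 'b) set \<Rightarrow> ('a set \<times> 'b set) set" where
  "max_rectangles_2 D\<^sub>1 D\<^sub>2 \<Omega> =
     {(I\<^sub>1, I\<^sub>2). I\<^sub>1 \<in> dyadic_cubes D\<^sub>1 \<and> I\<^sub>2 \<in> dyadic_cubes D\<^sub>2 \<and> I\<^sub>1 \<times> I\<^sub>2 \<subseteq> \<Omega> \<and>
        (\<forall>J\<in>dyadic_cubes D\<^sub>2. I\<^sub>2 \<subseteq> J \<and> I\<^sub>1 \<times> J \<subseteq> \<Omega> \<longrightarrow> J = I\<^sub>2)}"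

text \<open>Greatest with respect to inclusion.\<close>

definition hat_2 ::
    "(int \<Rightarrow> 'b set set) \<Rightarrow> ('a \<times> 'b) measure \<Rightarrow> ('a \<times> 'b) set \<Rightarrow> 'a set \<Rightarrow> 'b set \<Rightarrow> 'b set" where
  "hat_2 D\<^sub>2 \<mu> \<Omega> I\<^sub>1 I\<^sub>2 =
     (GREATEST J. J \<in> dyadic_cubes D\<^sub>2 \<and> I\<^sub>2 \<subseteq> J \<and>
        measure \<mu> ((I\<^sub>1 \<times> J) \<inter> \<Omega>) > 1/2 * measure \<mu> (I\<^sub>1 \<times> J))"

definition hat_1 ::
    "(int \<Rightarrow> 'a set set) \<Rightarrow> ('a \<times> 'b) measure \<Rightarrow> ('a \<times> 'b) set \<Rightarrow> 'a set \<Rightarrow> 'b set \<Rightarrow> 'a set" where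
  "hat_1 D\<^sub>1 \<mu> \<Omega> I\<^sub>1 I\<^sub>2 =
     (GREATEST J. J \<in> dyadic_cubes D\<^sub>1 \<and> I\<^sub>1 \<subseteq> J \<and>
        measure \<mu> ((J \<times> I\<^sub>2) \<inter> \<Omega>) > 1/2 * measure \<mu> (J \<times> I\<^sub>2))"

end

theory Submission
  imports Defs
begin

text \<open>
  This is Journe's covering argument. Fix \<open>I\<^sub>2\<close>; the cubes \<open>I\<^sub>1\<close> with \<open>I\<^sub>1 \<times> I\<^sub>2\<close> in \<open>\<M>\<^sub>1(\<Omega>)\<close> are
  disjoint by maximality. Write \<open>E\<^sub>J\<close> for the union of the cubes \<open>I\<^sub>1\<close> with \<open>I\<^sub>1 \<times> J \<subseteq> \<Omega>\<close>, and let
  \<open>J\<close> be the smallest cube above \<open>I\<^sub>2\<close> with \<open>\<mu>\<^sub>2(J) \<ge> 2\<^bsup>j+1\<^esup> \<mu>\<^sub>2(I\<^sub>2)\<close>. If the ratio of \<open>\<mu>\<^sub>2(I\<^sub>2)\<close> to the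
  measure of the enlarged cube is about \<open>2\<^bsup>-j\<^esup>\<close>, then \<open>J\<close> exceeds the enlarged cube, so at least half of
  \<open>I\<^sub>1\<close> lies outside \<open>E\<^sub>J\<close>. A point \<open>(x\<^sub>1, x\<^sub>2)\<close> of \<open>\<Omega>\<close> lies in \<open>(I\<^sub>1 - E\<^sub>J) \<times> I\<^sub>2\<close> only for cubes \<open>I\<^sub>2\<close> that
  form a chain with measures comparable up to the factor \<open>2\<^bsup>j+1\<^esup>\<close>. Such a chain has \<open>O(j + 1)\<close> members,
  so the rectangles of class \<open>j\<close> have total measure \<open>O((j + 1) \<mu>(\<Omega>))\<close>, and the sum over \<open>j\<close> against
  \<open>w(2\<^bsup>-j\<^esup>)\<close> converges.

  The length bound for chains amounts to a reverse doubling property of the cubes. It holds because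
  two points of a common cube have finite control distance, so that a curve of finite length joins
  them and passes through all intermediate distances.
\<close>

section \<open>The control metric\<close>

lemma absolutely_continuous_fun_compose:
  assumes g: "absolutely_continuous_fun g"
    and range: "u ` {0..1} \<subseteq> {0..1}"
    and mono: "mono_on {0..1} u \<or> antimono_on {0..1} u"
    and L: "L-lipschitz_on {0..1} u"
  shows "absolutely_continuous_fun (g \<circ> u)"
  unfolding absolutely_continuous_fun_def
proof (intro allI impI)
  fix \<epsilon> :: real assume "\<epsilon> > 0"
  with g obtain \<delta> where "\<delta> > 0" and \<delta>: "\<And>(n::nat) s t.
        (\<forall>i<n. 0 \<le> s i \<and> s i \<le> t i \<and> t i \<le> 1) \<and>
        disjoint_family_on (\<lambda>i. {s i<..<t i}) {..<n} \<and>
        (\<Sum>i<n. t i - s i) < \<delta> \<Longrightarrow> (\<Sum>i<n. \<bar>g (t i) - g (s i)\<bar>) < \<epsilon>"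
    unfolding absolutely_continuous_fun_def by meson
  have "L \<ge> 0" using L lipschitz_on_nonneg by blast
  show "\<exists>\<delta>>0. \<forall>(n::nat) s t.
        (\<forall>i<n. 0 \<le> s i \<and> s i \<le> t i \<and> t i \<le> 1) \<and>
        disjoint_family_on (\<lambda>i. {s i<..<t i}) {..<n} \<and>
        (\<Sum>i<n. t i - s i) < \<delta> \<longrightarrow> (\<Sum>i<n. \<bar>(g \<circ> u) (t i) - (g \<circ> u) (s i)\<bar>) < \<epsilon>"
  \<comment> \<open>Total length grows at most by the factor \<open>L\<close> under
    \<open>u\<close>; dividing by \<open>L + 1\<close> stays meaningful when
    \<open>L = 0\<close>.\<close>
  proof (intro exI[of _ "\<delta> / (L + 1)"] conjI allI impI)
    show "0 < \<delta> / (L + 1)" using \<open>\<delta> > 0\<close> \<open>L \<ge> 0\<close> by simp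
    fix n :: nat and s t :: "nat \<Rightarrow> real"
    assume A: "(\<forall>i<n. 0 \<le> s i \<and> s i \<le> t i \<and> t i \<le> 1) \<and>
        disjoint_family_on (\<lambda>i. {s i<..<t i}) {..<n} \<and> (\<Sum>i<n. t i - s i) < \<delta> / (L + 1)"
    \<comment> \<open>Since \<open>u\<close> may be decreasing, the end points of each image
      interval are sorted. The increments of \<open>g\<close> change at most their sign, which the
      absolute value absorbs.\<close>
    define s' where "s' i = min (u (s i)) (u (t i))" for i
    define t' where "t' i = max (u (s i)) (u (t i))" for i
    have in01: "s i \<in> {0..1}" "t i \<in> {0..1}" if "i < n" for i
      using A that by (auto intro: order_trans)
    have u01: "u (s i) \<in> {0..1}" "u (t i) \<in> {0..1}" if "i < n" for i
      using in01[OF that] range by blast+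
    have "(\<Sum>i<n. \<bar>g (t' i) - g (s' i)\<bar>) < \<epsilon>"
    proof (rule \<delta>, intro conjI allI impI)
      fix i assume "i < n"
      then show "0 \<le> s' i" "s' i \<le> t' i" "t' i \<le> 1"
        using u01[of i] by (auto simp: s'_def t'_def)
    next
      show "disjoint_family_on (\<lambda>i. {s' i<..<t' i}) {..<n}"
        unfolding disjoint_family_on_def
      proof (intro ballI impI, rule ccontr)
        fix i j assume ij: "i \<in> {..<n}" "j \<in> {..<n}" "i \<noteq> j"
          and "{s' i<..<t' i} \<inter> {s' j<..<t' j} \<noteq> {}"
        then obtain c where "c \<in> {s' i<..<t' i} \<inter> {s' j<..<t' j}" by blast
        then have c: "s' i < c" "c < t' i" "s' j < c" "c < t' j" by simp_all
        \<comment> \<open>An interval whose image has \<open>c\<close> in its interior is not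
          degenerate. Two disjoint nondegenerate intervals lie side by side, and by monotonicity so
          do their images; hence \<open>c\<close> cannot be interior to both. A merely Lipschitz map
          could fold the images over each other.\<close>
        have lt: "s k < t k" if "k \<in> {i, j}" for k
        proof (rule ccontr)
          assume "\<not> s k < t k"
          with A ij that have "s k = t k" by (metis insert_iff lessThan_iff order_le_less singletonD)
          then show False using c that by (auto simp: s'_def t'_def)
        qed
        have "t i \<le> s j \<or> t j \<le> s i"
        proof (rule ccontr)
          assume "\<not> (t i \<le> s j \<or> t j \<le> s i)"
          then have "max (s i) (s j) < min (t i) (t j)" using lt by auto
          then obtain e where "max (s i) (s j) < e" "e < min (t i) (t j)" using dense by blast
          then have "e \<in> {s i<..<t i} \<inter> {s j<..<t j}" by auto
          then show False using A ij unfolding disjoint_family_on_def by blast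
        qed
        with mono c show False
          using in01[of i] in01[of j] ij lt[of i] lt[of j]
          unfolding monotone_on_def s'_def t'_def min_def max_def
          by (smt (verit, best) insertCI lessThan_iff)
      qed
    next
      have "(\<Sum>i<n. t' i - s' i) = (\<Sum>i<n. dist (u (t i)) (u (s i)))"
        by (intro sum.cong) (auto simp: s'_def t'_def dist_real_def)
      also have "\<dots> \<le> (\<Sum>i<n. L * (t i - s i))"
      proof (intro sum_mono)
        fix i assume "i \<in> {..<n}"
        then show "dist (u (t i)) (u (s i)) \<le> L * (t i - s i)"
          using lipschitz_onD[OF L in01(2) in01(1), of i i] A by (auto simp: dist_real_def)
      qed
      also have "\<dots> \<le> (\<Sum>i<n. (L + 1) * (t i - s i))"
        using A by (intro sum_mono mult_right_mono) auto
      also have "\<dots> = (L + 1) * (\<Sum>i<n. t i - s i)" by (simp add: sum_distrib_left)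
      also have "\<dots> < \<delta>" using A \<open>L \<ge> 0\<close> by (auto simp: field_simps)
      finally show "(\<Sum>i<n. t' i - s' i) < \<delta>" .
    qed
    also have "(\<Sum>i<n. \<bar>g (t' i) - g (s' i)\<bar>) = (\<Sum>i<n. \<bar>(g \<circ> u) (t i) - (g \<circ> u) (s i)\<bar>)"
      by (intro sum.cong) (auto simp: s'_def t'_def min_def max_def)
    finally show "(\<Sum>i<n. \<bar>(g \<circ> u) (t i) - (g \<circ> u) (s i)\<bar>) < \<epsilon>" .
  qed
qed

lemma absolutely_continuous_fun_const: "absolutely_continuous_fun (\<lambda>_. c)"
  unfolding absolutely_continuous_fun_def by (auto intro: exI[of _ 1])

lemma absolutely_continuous_fun_add:
  assumes "absolutely_continuous_fun f" "absolutely_continuous_fun g"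
  shows "absolutely_continuous_fun (\<lambda>t. f t + g t)"
  unfolding absolutely_continuous_fun_def
proof (intro allI impI)
  fix \<epsilon> :: real assume "\<epsilon> > 0"
  then have "\<epsilon> / 2 > 0" by simp
  let ?P = "\<lambda>f \<epsilon> \<delta>. \<forall>(n::nat) s t.
        (\<forall>i<n. 0 \<le> s i \<and> s i \<le> t i \<and> t i \<le> 1) \<and>
        disjoint_family_on (\<lambda>i. {s i<..<t i}) {..<n} \<and>
        (\<Sum>i<n. t i - s i) < \<delta> \<longrightarrow> (\<Sum>i<n. \<bar>f (t i) - f (s i)\<bar>) < \<epsilon>"
  from assms(1) \<open>\<epsilon> / 2 > 0\<close> obtain \<delta>1 where 1: "\<delta>1 > 0" "?P f (\<epsilon>/2) \<delta>1"
    unfolding absolutely_continuous_fun_def by meson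
  from assms(2) \<open>\<epsilon> / 2 > 0\<close> obtain \<delta>2 where 2: "\<delta>2 > 0" "?P g (\<epsilon>/2) \<delta>2"
    unfolding absolutely_continuous_fun_def by meson
  show "\<exists>\<delta>>0. ?P (\<lambda>t. f t + g t) \<epsilon> \<delta>"
  proof (intro exI[of _ "min \<delta>1 \<delta>2"] conjI allI impI)
    show "0 < min \<delta>1 \<delta>2" using 1 2 by simp
    fix n :: nat and s t :: "nat \<Rightarrow> real"
    assume A: "(\<forall>i<n. 0 \<le> s i \<and> s i \<le> t i \<and> t i \<le> 1) \<and>
        disjoint_family_on (\<lambda>i. {s i<..<t i}) {..<n} \<and> (\<Sum>i<n. t i - s i) < min \<delta>1 \<delta>2"
    then have "(\<Sum>i<n. \<bar>f (t i) - f (s i)\<bar>) < \<epsilon> / 2" "(\<Sum>i<n. \<bar>g (t i) - g (s i)\<bar>) < \<epsilon> / 2"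
      using 1(2) 2(2) by auto
    moreover have "(\<Sum>i<n. \<bar>f (t i) + g (t i) - (f (s i) + g (s i))\<bar>) \<le>
        (\<Sum>i<n. \<bar>f (t i) - f (s i)\<bar> + \<bar>g (t i) - g (s i)\<bar>)"
      by (intro sum_mono) linarith
    ultimately show "(\<Sum>i<n. \<bar>f (t i) + g (t i) - (f (s i) + g (s i))\<bar>) < \<epsilon>"
      by (simp add: sum.distrib)
  qed
qed

text \<open>Since \<open>P\<close> may fail to be measurable, the affine substitution is applied to
  the complement of a Borel null set \<open>N\<close> that contains all exceptional points.\<close>

lemma AE_lborel_affine:
  fixes P :: "real \<Rightarrow> bool"
  assumes "AE x in lborel. P x" "c \<noteq> 0"
  shows "AE x in lborel. P (b + c * x)"
proof -
  from assms(1) obtain N where N: "N \<in> null_sets lborel" "{x. \<not> P x} \<subseteq> N"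
    by (auto elim!: AE_E simp: null_sets_def)
  have "AE x in lborel. x \<notin> N" using N(1) by (rule AE_not_in)
  moreover have "Measurable.pred borel (\<lambda>x. x \<notin> N)"
    using N(1) by (auto simp: null_sets_def intro!: predE pred_intros_logic)
  ultimately have "AE x in lborel. b + c * x \<notin> N"
    using AE_borel_affine[OF assms(2), of "\<lambda>x. x \<notin> N" b] by simp
  then show ?thesis using N(2) by (auto elim!: eventually_mono)
qed

section \<open>Constant, reparametrized and joined admissible curves\<close>

lemma admissible_curve_const:
  assumes "\<delta> > 0" shows "admissible_curve \<A> Xs \<delta> (\<lambda>_. p)"
  unfolding admissible_curve_def absolutely_continuous_curve_def comp_def
  using assms by (intro conjI exI[of _ "\<lambda>_ _. 0"] AE_I2)
    (auto intro: absolutely_continuous_fun_const)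

text \<open>By the chain rule the controls are multiplied by \<open>c\<close>, so their bound scales
  by \<open>\<bar>c\<bar>\<close>. Two cases matter later: \<open>c = -1\<close> with
  \<open>b = 1\<close> reverses a curve, and \<open>c = 1 / n\<close> cuts out one of
  \<open>n\<close> equal time pieces.\<close>

lemma admissible_curve_affine:
  assumes adm: "admissible_curve \<A> Xs \<delta> \<gamma>" and b: "b \<in> {0..1}" "b + c \<in> {0..1}" and "c \<noteq> 0"
  shows "admissible_curve \<A> Xs (\<delta> * \<bar>c\<bar>) (\<lambda>t. \<gamma> (b + c * t))"
proof -
  let ?u = "\<lambda>t. b + c * t"
  have u: "?u t \<in> {0..1}" if "t \<in> {0..1}" for t
  proof -
    have "?u t = (1 - t) * b + t * (b + c)" by (simp add: algebra_simps)
    also have "\<dots> \<in> {0..1}"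
      using b that convex_bound_le[of b 1 "b + c" "1 - t" t] by auto
    finally show ?thesis .
  qed
  from adm obtain a where cont: "continuous_on {0..1} \<gamma>"
    and ac: "\<And>f. smooth_function \<A> f \<Longrightarrow> absolutely_continuous_fun (f \<circ> \<gamma>)"
    and a: "AE t in lborel. t \<in> {0..1} \<longrightarrow>
        (\<forall>f. smooth_function \<A> f \<longrightarrow>
           ((f \<circ> \<gamma>) has_real_derivative (\<Sum>j<length Xs. a j t * (Xs ! j) f (\<gamma> t))) (at t within {0..1})) \<and>
        (\<Sum>j<length Xs. \<bar>a j t\<bar>\<^sup>2) < \<delta>\<^sup>2"
    unfolding admissible_curve_def absolutely_continuous_curve_def by auto
  have "continuous_on {0..1} (\<lambda>t. \<gamma> (?u t))"
    using u by (intro continuous_on_compose2[OF cont] continuous_intros) auto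
  moreover have "absolutely_continuous_fun (f \<circ> (\<lambda>t. \<gamma> (?u t)))" if "smooth_function \<A> f" for f
  proof -
    have "absolutely_continuous_fun ((f \<circ> \<gamma>) \<circ> ?u)"
    proof (rule absolutely_continuous_fun_compose[OF ac[OF that]])
      show "?u ` {0..1} \<subseteq> {0..1}" using u by blast
      show "mono_on {0..1} ?u \<or> antimono_on {0..1} ?u"
        unfolding monotone_on_def by (cases "c \<ge> 0") (auto simp: mult_left_mono mult_left_mono_neg)
      show "\<bar>c\<bar>-lipschitz_on {0..1} ?u"
        by (rule lipschitz_onI) (auto simp: dist_real_def abs_mult[symmetric] algebra_simps)
    qed
    then show ?thesis by (simp add: comp_def)
  qed
  moreover have "AE t in lborel. t \<in> {0..1} \<longrightarrow>
        (\<forall>f. smooth_function \<A> f \<longrightarrow>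
           ((f \<circ> (\<lambda>t. \<gamma> (?u t))) has_real_derivative
              (\<Sum>j<length Xs. (c * a j (?u t)) * (Xs ! j) f (\<gamma> (?u t)))) (at t within {0..1})) \<and>
        (\<Sum>j<length Xs. \<bar>c * a j (?u t)\<bar>\<^sup>2) < (\<delta> * \<bar>c\<bar>)\<^sup>2"
    using AE_lborel_affine[OF a \<open>c \<noteq> 0\<close>, of b]
  proof eventually_elim
    case (elim t)
    show ?case
    proof (intro impI conjI allI)
      assume t: "t \<in> {0..1}"
      note e = elim[rule_format, OF u[OF t]]
      have "(\<Sum>j<length Xs. \<bar>c * a j (?u t)\<bar>\<^sup>2) = c\<^sup>2 * (\<Sum>j<length Xs. \<bar>a j (?u t)\<bar>\<^sup>2)"
        by (simp add: sum_distrib_left power_mult_distrib)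
      then show "(\<Sum>j<length Xs. \<bar>c * a j (?u t)\<bar>\<^sup>2) < (\<delta> * \<bar>c\<bar>)\<^sup>2"
        using e \<open>c \<noteq> 0\<close> by (simp add: power_mult_distrib)
      fix f assume f: "smooth_function \<A> f"
      have "((f \<circ> \<gamma>) has_real_derivative (\<Sum>j<length Xs. a j (?u t) * (Xs ! j) f (\<gamma> (?u t))))
              (at (?u t) within ?u ` {0..1})"
        using e f u by (blast intro: DERIV_subset)
      moreover have "(?u has_real_derivative c) (at t within {0..1})"
        by (auto intro!: derivative_eq_intros)
      ultimately have "((f \<circ> \<gamma>) \<circ> ?u has_real_derivative
          (\<Sum>j<length Xs. a j (?u t) * (Xs ! j) f (\<gamma> (?u t))) * c) (at t within {0..1})"
        by (rule DERIV_image_chain)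
      then show "((f \<circ> (\<lambda>t. \<gamma> (?u t))) has_real_derivative
              (\<Sum>j<length Xs. (c * a j (?u t)) * (Xs ! j) f (\<gamma> (?u t)))) (at t within {0..1})"
        by (simp add: comp_def sum_distrib_left mult_ac)
    qed
  qed
  ultimately show ?thesis
    unfolding admissible_curve_def absolutely_continuous_curve_def
    by (intro conjI exI[of _ "\<lambda>j t. c * a j (?u t)"]) auto
qed

lemma admissible_curve_join:
  assumes adm1: "admissible_curve \<A> Xs \<delta>1 \<gamma>1" and adm2: "admissible_curve \<A> Xs \<delta>2 \<gamma>2"
    and eq: "\<gamma>1 1 = \<gamma>2 0" and pos: "\<delta>1 > 0" "\<delta>2 > 0"
  obtains \<gamma> where "admissible_curve \<A> Xs (\<delta>1 + \<delta>2) \<gamma>" "\<gamma> 0 = \<gamma>1 0" "\<gamma> 1 = \<gamma>2 1"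
proof -
  \<comment> \<open>Time is divided in proportion to the two bounds, so that after rescaling the
    controls of both pieces obey the same bound \<open>\<delta>1 + \<delta>2\<close>.\<close>
  define l where "l = \<delta>1 / (\<delta>1 + \<delta>2)"
  have l: "0 < l" "l < 1" "\<delta>1 / l = \<delta>1 + \<delta>2" "\<delta>2 / (1 - l) = \<delta>1 + \<delta>2"
    using pos by (auto simp: l_def field_simps)
  let ?u = "\<lambda>t. t / l" and ?v = "\<lambda>t. (t - l) / (1 - l)"
  define \<gamma> where "\<gamma> t = (if t \<le> l then \<gamma>1 (?u t) else \<gamma>2 (?v t))" for t
  let ?P = "\<lambda>\<gamma> \<delta> a t. t \<in> {0..1} \<longrightarrow>
        (\<forall>f. smooth_function \<A> f \<longrightarrow>
           ((f \<circ> \<gamma>) has_real_derivative (\<Sum>j<length Xs. a j t * (Xs ! j) f (\<gamma> t))) (at t within {0..1})) \<and>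
        (\<Sum>j<length Xs. \<bar>a j t\<bar>\<^sup>2) < \<delta>\<^sup>2"
  from adm1 obtain a1 where cont1: "continuous_on {0..1} \<gamma>1"
    and ac1: "\<And>f. smooth_function \<A> f \<Longrightarrow> absolutely_continuous_fun (f \<circ> \<gamma>1)"
    and a1: "AE t in lborel. ?P \<gamma>1 \<delta>1 a1 t"
    unfolding admissible_curve_def absolutely_continuous_curve_def by auto
  from adm2 obtain a2 where cont2: "continuous_on {0..1} \<gamma>2"
    and ac2: "\<And>f. smooth_function \<A> f \<Longrightarrow> absolutely_continuous_fun (f \<circ> \<gamma>2)"
    and a2: "AE t in lborel. ?P \<gamma>2 \<delta>2 a2 t"
    unfolding admissible_curve_def absolutely_continuous_curve_def by auto
  define a where "a j t = (if t \<le> l then a1 j (?u t) / l else a2 j (?v t) / (1 - l))" for j t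
  have u: "?u t \<in> {0..1}" if "t \<in> {0..l}" for t using that l by (auto simp: field_simps)
  have v: "?v t \<in> {0..1}" if "t \<in> {l..1}" for t using that l by (auto simp: field_simps)
  have "continuous_on {0..1} \<gamma>"
  proof -
    have "continuous_on ({0..l} \<union> {l..1}) \<gamma>"
    proof (rule continuous_on_closed_Un)
      have "continuous_on {0..l} (\<lambda>t. \<gamma>1 (?u t))"
        using u l by (intro continuous_on_compose2[OF cont1] continuous_intros) auto
      then show "continuous_on {0..l} \<gamma>"
        by (rule continuous_on_eq) (auto simp: \<gamma>_def)
      have "continuous_on {l..1} (\<lambda>t. \<gamma>2 (?v t))"
        using v l by (intro continuous_on_compose2[OF cont2] continuous_intros) auto
      then show "continuous_on {l..1} \<gamma>"
        by (rule continuous_on_eq) (use eq l in \<open>auto simp: \<gamma>_def\<close>)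
    qed auto
    also have "{0..l} \<union> {l..1} = {0..1}" using l by auto
    finally show ?thesis .
  qed
  \<comment> \<open>Outside its own time interval each piece is frozen at the junction. Then
    \<open>f \<circ> \<gamma>\<close> is the sum of the two frozen functions minus the junction
    value, which is counted twice.\<close>
  moreover have "absolutely_continuous_fun (f \<circ> \<gamma>)" if f: "smooth_function \<A> f" for f
  proof -
    have 1: "absolutely_continuous_fun ((f \<circ> \<gamma>1) \<circ> (\<lambda>t. min (?u t) 1))"
    proof (rule absolutely_continuous_fun_compose[OF ac1[OF f]])
      show "(\<lambda>t. min (?u t) 1) ` {0..1} \<subseteq> {0..1}" using l by auto
      show "mono_on {0..1} (\<lambda>t. min (?u t) 1) \<or> antimono_on {0..1} (\<lambda>t. min (?u t) 1)"
        using l by (intro disjI1 mono_onI) (auto simp: min_def divide_right_mono field_simps)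
      show "(1 / l)-lipschitz_on {0..1} (\<lambda>t. min (?u t) 1)"
        using l by (intro lipschitz_onI) (auto simp: dist_real_def field_simps min_def abs_if)
    qed
    have 2: "absolutely_continuous_fun ((f \<circ> \<gamma>2) \<circ> (\<lambda>t. max (?v t) 0))"
    proof (rule absolutely_continuous_fun_compose[OF ac2[OF f]])
      show "(\<lambda>t. max (?v t) 0) ` {0..1} \<subseteq> {0..1}" using l by (auto simp: field_simps)
      show "mono_on {0..1} (\<lambda>t. max (?v t) 0) \<or> antimono_on {0..1} (\<lambda>t. max (?v t) 0)"
        using l by (intro disjI1 mono_onI max.mono divide_right_mono) auto
      show "(1 / (1 - l))-lipschitz_on {0..1} (\<lambda>t. max (?v t) 0)"
      proof (rule lipschitz_onI)
        fix x y :: real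
        have "dist (max (?v x) 0) (max (?v y) 0) \<le> \<bar>?v x - ?v y\<bar>"
          by (auto simp: dist_real_def)
        also have "?v x - ?v y = (x - y) / (1 - l)" by (simp add: diff_divide_distrib)
        finally show "dist (max (?v x) 0) (max (?v y) 0) \<le> 1 / (1 - l) * dist x y"
          using l by (simp add: dist_real_def)
      qed (use l in auto)
    qed
    have "absolutely_continuous_fun
        (\<lambda>t. (((f \<circ> \<gamma>1) \<circ> (\<lambda>t. min (?u t) 1)) t + ((f \<circ> \<gamma>2) \<circ> (\<lambda>t. max (?v t) 0)) t) + - f (\<gamma>2 0))"
      by (intro absolutely_continuous_fun_add absolutely_continuous_fun_const 1 2)
    moreover have "f \<circ> \<gamma> =
        (\<lambda>t. (((f \<circ> \<gamma>1) \<circ> (\<lambda>t. min (?u t) 1)) t + ((f \<circ> \<gamma>2) \<circ> (\<lambda>t. max (?v t) 0)) t) + - f (\<gamma>2 0))"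
      using l eq by (intro ext) (auto simp: \<gamma>_def min_def max_def field_simps)
    ultimately show ?thesis by simp
  qed
  moreover have "AE t in lborel. ?P \<gamma> (\<delta>1 + \<delta>2) a t"
  proof -
    have "AE t in lborel. ?P \<gamma>1 \<delta>1 a1 (0 + (1 / l) * t)"
      by (rule AE_lborel_affine[OF a1]) (use l in auto)
    moreover have "AE t in lborel. ?P \<gamma>2 \<delta>2 a2 (- l / (1 - l) + (1 / (1 - l)) * t)"
      by (rule AE_lborel_affine[OF a2]) (use l in auto)
    \<comment> \<open>At the junction the one-sided derivatives may disagree; this single time is
      discarded as a null set.\<close>
    moreover have "AE t in lborel. t \<noteq> l" by (rule AE_lborel_singleton)
    ultimately show ?thesis
    proof eventually_elim
      case (elim t)
      have e1: "?P \<gamma>1 \<delta>1 a1 (?u t)" using elim(1) by simp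
      have v_eq: "- l / (1 - l) + (1 / (1 - l)) * t = ?v t" by (simp add: diff_divide_distrib)
      have e2: "?P \<gamma>2 \<delta>2 a2 (?v t)" using elim(2) unfolding v_eq .
      have sum_sq: "(\<Sum>j<length Xs. \<bar>b j / c\<bar>\<^sup>2) = (\<Sum>j<length Xs. \<bar>b j\<bar>\<^sup>2) / c\<^sup>2"
        for b :: "nat \<Rightarrow> real" and c
        by (simp add: sum_divide_distrib power_divide)
      show ?case
      proof (intro impI)
        assume t: "t \<in> {0..1}"
        show "(\<forall>f. smooth_function \<A> f \<longrightarrow>
           ((f \<circ> \<gamma>) has_real_derivative (\<Sum>j<length Xs. a j t * (Xs ! j) f (\<gamma> t))) (at t within {0..1})) \<and>
           (\<Sum>j<length Xs. \<bar>a j t\<bar>\<^sup>2) < (\<delta>1 + \<delta>2)\<^sup>2"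
        proof (cases "t < l")
          case True
          then have ut: "?u t \<in> {0..1}" using u t by auto
          have "(\<Sum>j<length Xs. \<bar>a j t\<bar>\<^sup>2) = (\<Sum>j<length Xs. \<bar>a1 j (?u t)\<bar>\<^sup>2) / l\<^sup>2"
            using True sum_sq by (simp add: a_def)
          also have "\<dots> < \<delta>1\<^sup>2 / l\<^sup>2" using e1 ut l by (intro divide_strict_right_mono) auto
          also have "\<dots> = (\<delta>1 + \<delta>2)\<^sup>2" by (simp add: l(3) flip: power_divide)
          finally have "(\<Sum>j<length Xs. \<bar>a j t\<bar>\<^sup>2) < (\<delta>1 + \<delta>2)\<^sup>2" .
          moreover have "((f \<circ> \<gamma>) has_real_derivative
              (\<Sum>j<length Xs. a j t * (Xs ! j) f (\<gamma> t))) (at t within {0..1})"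
            if f: "smooth_function \<A> f" for f
          proof -
            let ?D = "\<Sum>j<length Xs. a1 j (?u t) * (Xs ! j) f (\<gamma>1 (?u t))"
            have "?u ` {0..l} \<subseteq> {0..1}" using u by blast
            then have "((f \<circ> \<gamma>1) has_real_derivative ?D) (at (?u t) within ?u ` {0..l})"
              using e1 ut f by (blast intro: DERIV_subset)
            moreover have "(?u has_real_derivative 1 / l) (at t within {0..l})"
              using l by (auto intro!: derivative_eq_intros)
            ultimately have "((f \<circ> \<gamma>1) \<circ> ?u has_real_derivative ?D * (1 / l)) (at t within {0..l})"
              by (rule DERIV_image_chain)
            then have "((f \<circ> \<gamma>) has_real_derivative ?D * (1 / l)) (at t within {0..l})"
              by (rule has_field_derivative_transform_within[where d = 1]) (use True t in \<open>auto simp: \<gamma>_def\<close>)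
            moreover have "at t within {0..l} = at t within {0..1}"
              using True l by (intro at_within_nhd[of t "{..<l}"]) auto
            moreover have "?D * (1 / l) = (\<Sum>j<length Xs. a j t * (Xs ! j) f (\<gamma> t))"
              using True by (simp add: a_def \<gamma>_def sum_divide_distrib)
            ultimately show ?thesis by simp
          qed
          ultimately show ?thesis by blast
        next
          case False
          with elim(3) have lt: "l < t" by simp
          then have vt: "?v t \<in> {0..1}" using v t by auto
          have "(\<Sum>j<length Xs. \<bar>a j t\<bar>\<^sup>2) = (\<Sum>j<length Xs. \<bar>a2 j (?v t)\<bar>\<^sup>2) / (1 - l)\<^sup>2"
            using lt sum_sq by (simp add: a_def)
          also have "\<dots> < \<delta>2\<^sup>2 / (1 - l)\<^sup>2" using e2 vt l by (intro divide_strict_right_mono) auto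
          also have "\<dots> = (\<delta>1 + \<delta>2)\<^sup>2" by (simp add: l(4) flip: power_divide)
          finally have "(\<Sum>j<length Xs. \<bar>a j t\<bar>\<^sup>2) < (\<delta>1 + \<delta>2)\<^sup>2" .
          moreover have "((f \<circ> \<gamma>) has_real_derivative
              (\<Sum>j<length Xs. a j t * (Xs ! j) f (\<gamma> t))) (at t within {0..1})"
            if f: "smooth_function \<A> f" for f
          proof -
            let ?D = "\<Sum>j<length Xs. a2 j (?v t) * (Xs ! j) f (\<gamma>2 (?v t))"
            have "?v ` {l..1} \<subseteq> {0..1}" using v by blast
            then have "((f \<circ> \<gamma>2) has_real_derivative ?D) (at (?v t) within ?v ` {l..1})"
              using e2 vt f by (blast intro: DERIV_subset)
            moreover have "(?v has_real_derivative 1 / (1 - l)) (at t within {l..1})"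
              using l by (auto intro!: derivative_eq_intros)
            ultimately have "((f \<circ> \<gamma>2) \<circ> ?v has_real_derivative ?D * (1 / (1 - l))) (at t within {l..1})"
              by (rule DERIV_image_chain)
            then have "((f \<circ> \<gamma>) has_real_derivative ?D * (1 / (1 - l))) (at t within {l..1})"
              by (rule has_field_derivative_transform_within[where d = 1]) (use lt t eq l in \<open>auto simp: \<gamma>_def\<close>)
            moreover have "at t within {l..1} = at t within {0..1}"
              using lt l by (intro at_within_nhd[of t "{l<..}"]) auto
            moreover have "?D * (1 / (1 - l)) = (\<Sum>j<length Xs. a j t * (Xs ! j) f (\<gamma> t))"
              using lt by (simp add: a_def \<gamma>_def sum_divide_distrib)
            ultimately show ?thesis by simp
          qed
          ultimately show ?thesis by blast
        qed
      qed
    qed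
  qed
  ultimately have "admissible_curve \<A> Xs (\<delta>1 + \<delta>2) \<gamma>"
    unfolding admissible_curve_def absolutely_continuous_curve_def by blast
  moreover have "\<gamma> 0 = \<gamma>1 0" "\<gamma> 1 = \<gamma>2 1" using l by (auto simp: \<gamma>_def)
  ultimately show thesis using that by blast
qed

section \<open>The control metric as a pseudometric that may be infinite, and its intermediate
  values\<close>

lemma control_metric_le:
  assumes "admissible_curve \<A> Xs \<delta> \<gamma>" "\<delta> > 0" "\<gamma> 0 = p" "\<gamma> 1 = q"
  shows "control_metric \<A> Xs p q \<le> ennreal \<delta>"
  unfolding control_metric_def using assms by (intro Inf_lower) auto

lemma control_metric_lessE:
  assumes "control_metric \<A> Xs p q < c"
  obtains \<delta> \<gamma> where "admissible_curve \<A> Xs \<delta> \<gamma>" "\<delta> > 0" "\<gamma> 0 = p" "\<gamma> 1 = q" "ennreal \<delta> < c"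
  using assms unfolding control_metric_def Inf_less_iff by auto

lemma control_metric_refl: "control_metric \<A> Xs p p = 0"
proof -
  have "control_metric \<A> Xs p p \<le> ennreal e" if "e > 0" for e
    using admissible_curve_const[OF that] that by (rule control_metric_le) auto
  then have "control_metric \<A> Xs p p \<le> 0 + ennreal e" if "e > 0" for e using that by simp
  then have "control_metric \<A> Xs p p \<le> 0" by (rule ennreal_le_epsilon)
  then show ?thesis by simp
qed

lemma control_metric_sym: "control_metric \<A> Xs p q = control_metric \<A> Xs q p"
proof -
  have "control_metric \<A> Xs q p \<le> control_metric \<A> Xs p q" for p q
  proof (rule dense_ge)
    fix c assume "control_metric \<A> Xs p q < c"
    then obtain \<delta> \<gamma> where g: "admissible_curve \<A> Xs \<delta> \<gamma>" "\<delta> > 0" "\<gamma> 0 = p" "\<gamma> 1 = q" "ennreal \<delta> < c"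
      by (rule control_metric_lessE)
    have "control_metric \<A> Xs q p \<le> ennreal (\<delta> * \<bar>-1\<bar>)"
      by (rule control_metric_le[OF admissible_curve_affine[OF g(1), of 1 "-1"]]) (use g in auto)
    then show "control_metric \<A> Xs q p \<le> c" using g by simp
  qed
  then show ?thesis by (intro antisym)
qed

text \<open>Joining two nearly optimal curves adds their bounds. Such curves exist only for finite
  distances, but an infinite distance on the right makes the claim trivial.\<close>

lemma control_metric_triangle:
  "control_metric \<A> Xs p s \<le> control_metric \<A> Xs p q + control_metric \<A> Xs q s"
proof (cases "control_metric \<A> Xs p q = \<infinity> \<or> control_metric \<A> Xs q s = \<infinity>")
  case False
  show ?thesis
  proof (rule ennreal_le_epsilon)
    fix e :: real assume "e > 0"
    from False \<open>e > 0\<close> have "control_metric \<A> Xs p q < control_metric \<A> Xs p q + ennreal (e/2)"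
      "control_metric \<A> Xs q s < control_metric \<A> Xs q s + ennreal (e/2)"
      by (auto simp: ennreal_add_left_cancel_less less_top
          intro!: ennreal_add_left_cancel_less[THEN iffD2, of _ 0, simplified])
    then obtain \<delta>1 \<gamma>1 \<delta>2 \<gamma>2 where g1: "admissible_curve \<A> Xs \<delta>1 \<gamma>1" "\<delta>1 > 0" "\<gamma>1 0 = p" "\<gamma>1 1 = q"
        "ennreal \<delta>1 < control_metric \<A> Xs p q + ennreal (e/2)"
      and g2: "admissible_curve \<A> Xs \<delta>2 \<gamma>2" "\<delta>2 > 0" "\<gamma>2 0 = q" "\<gamma>2 1 = s"
        "ennreal \<delta>2 < control_metric \<A> Xs q s + ennreal (e/2)"
      by (metis control_metric_lessE)
    obtain \<gamma> where "admissible_curve \<A> Xs (\<delta>1 + \<delta>2) \<gamma>" "\<gamma> 0 = p" "\<gamma> 1 = s"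
      using admissible_curve_join[OF g1(1) g2(1)] g1 g2 by metis
    then have "control_metric \<A> Xs p s \<le> ennreal (\<delta>1 + \<delta>2)"
      using g1(2) g2(2) by (intro control_metric_le[of _ _ _ \<gamma>]) auto
    also have "\<dots> = ennreal \<delta>1 + ennreal \<delta>2" using g1 g2 by simp
    also have "\<dots> \<le> (control_metric \<A> Xs p q + ennreal (e/2)) + (control_metric \<A> Xs q s + ennreal (e/2))"
      using g1 g2 by (intro add_mono) auto
    also have "\<dots> = control_metric \<A> Xs p q + control_metric \<A> Xs q s + (ennreal (e/2) + ennreal (e/2))"
      by (simp add: add_ac)
    also have "ennreal (e/2) + ennreal (e/2) = ennreal e"
      using \<open>e > 0\<close> by (simp flip: ennreal_plus)
    finally show "control_metric \<A> Xs p s \<le> control_metric \<A> Xs p q + control_metric \<A> Xs q s + ennreal e" .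
  qed
qed auto

text \<open>A curve from \<open>p\<close> to \<open>q\<close> is cut into \<open>n\<close> equal
  pieces, each of bound \<open>\<delta> / n < s\<close>. The first division point at distance at
  least \<open>s\<close> from \<open>p\<close> is one such step away from a point at distance less
  than \<open>s\<close>, hence at distance less than \<open>2 * s\<close>.\<close>

lemma control_metric_intermediate:
  assumes fin: "control_metric \<A> Xs p q < \<infinity>" and s: "0 < s" "ennreal s \<le> control_metric \<A> Xs p q"
  obtains z where "ennreal s \<le> control_metric \<A> Xs p z" "control_metric \<A> Xs p z < ennreal (2 * s)"
proof -
  obtain \<delta> \<gamma> where g: "admissible_curve \<A> Xs \<delta> \<gamma>" "\<delta> > 0" "\<gamma> 0 = p" "\<gamma> 1 = q"
    using fin by (rule control_metric_lessE)
  define n where "n = nat \<lceil>\<delta> / s\<rceil> + 1"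
  have n: "n > 0" "\<delta> / real n < s"
  proof -
    have "\<delta> / s < real n" unfolding n_def by linarith
    then show "\<delta> / real n < s" using s by (simp add: n_def field_simps)
  qed (simp add: n_def)
  let ?z = "\<lambda>i. \<gamma> (real i / real n)"
  define i where "i = (LEAST i. ennreal s \<le> control_metric \<A> Xs p (?z i))"
  have ex: "ennreal s \<le> control_metric \<A> Xs p (?z n)" using g n s by simp
  then have i: "ennreal s \<le> control_metric \<A> Xs p (?z i)" "i \<le> n"
    unfolding i_def by (rule LeastI, rule Least_le)
  have "i \<noteq> 0"
  proof
    assume "i = 0"
    then show False using i g s control_metric_refl[of \<A> Xs p] by simp
  qed
  then obtain k where k: "i = Suc k" using not0_implies_Suc by blast
  have lt: "control_metric \<A> Xs p (?z k) < ennreal s"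
    using not_less_Least[of k "\<lambda>i. ennreal s \<le> control_metric \<A> Xs p (?z i)"] k
    unfolding i_def by auto
  have "control_metric \<A> Xs (?z k) (?z i) \<le> ennreal (\<delta> * \<bar>1 / real n\<bar>)"
    by (rule control_metric_le[OF admissible_curve_affine[OF g(1), of "real k / real n" "1 / real n"]])
      (use g n i k in \<open>auto simp: field_simps\<close>)
  also have "\<dots> \<le> ennreal s" using n by (intro ennreal_leI) simp
  finally have step: "control_metric \<A> Xs (?z k) (?z i) \<le> ennreal s" .
  have "control_metric \<A> Xs p (?z i) \<le> control_metric \<A> Xs p (?z k) + control_metric \<A> Xs (?z k) (?z i)"
    by (rule control_metric_triangle)
  also have "\<dots> \<le> ennreal s + control_metric \<A> Xs p (?z k)"
    using step by (subst add.commute) (rule add_right_mono)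
  also have "\<dots> < ennreal s + ennreal s"
    using lt by (simp add: ennreal_add_left_cancel_less)
  also have "\<dots> = ennreal (2 * s)" using s by (simp flip: ennreal_plus)
  finally show thesis using that i by blast
qed


section \<open>Growth of dyadic cubes\<close>

text \<open>This is the interface between the geometry of the cubes and the covering argument. The
  last assumption is reverse doubling in counting form: few cubes around a point can have measures
  within a factor \<open>2 ^ Suc j\<close> of each other. It counts cubes as sets, so it tolerates a
  set that recurs in infinitely many generations.\<close>

locale dyadic_system =
  fixes M :: "'a::second_countable_topology measure" and D :: "int \<Rightarrow> 'a set set" and K :: nat
  assumes sets_M: "sets M = sets borel"
    and sigma_finite_M: "sigma_finite_measure M"
    and open_cube: "I \<in> dyadic_cubes D \<Longrightarrow> open I"
    and emeasure_cube_pos: "I \<in> dyadic_cubes D \<Longrightarrow> 0 < emeasure M I"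
    and emeasure_cube_finite: "I \<in> dyadic_cubes D \<Longrightarrow> emeasure M I < \<infinity>"
    and nested: "I \<in> dyadic_cubes D \<Longrightarrow> J \<in> dyadic_cubes D \<Longrightarrow> I \<subseteq> J \<or> J \<subseteq> I \<or> I \<inter> J = {}"
    and card_chain_le: "finite \<C> \<Longrightarrow> \<C> \<subseteq> dyadic_cubes D \<Longrightarrow> x \<in> \<Inter>\<C> \<Longrightarrow>
      (\<And>I J. I \<in> \<C> \<Longrightarrow> J \<in> \<C> \<Longrightarrow> I \<subseteq> J \<Longrightarrow> measure M J < 2 ^ Suc j * measure M I) \<Longrightarrow>
      card \<C> \<le> K * Suc j"

section \<open>Doubling, and measure bounds for single cubes\<close>

lemma mball_control_metric_memI: "r > 0 \<Longrightarrow> x \<in> mball (control_metric \<A> Xs) x r"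
  by (simp add: mball_def control_metric_refl)

lemma doubling_iterate:
  assumes "doubling d \<mu>"
  obtains C where "C > 0"
    "\<And>x r m. r > 0 \<Longrightarrow> emeasure \<mu> (mball d x (2 ^ m * r)) \<le> ennreal (C ^ m) * emeasure \<mu> (mball d x r)"
proof -
  from assms obtain C where C: "C > 0"
    "\<And>x r. r > 0 \<Longrightarrow> emeasure \<mu> (mball d x (2 * r)) \<le> ennreal C * emeasure \<mu> (mball d x r)"
    unfolding doubling_def by blast
  have "emeasure \<mu> (mball d x (2 ^ m * r)) \<le> ennreal (C ^ m) * emeasure \<mu> (mball d x r)"
    if "r > 0" for x r and m :: nat
  proof (induction m)
    case (Suc m)
    have "emeasure \<mu> (mball d x (2 ^ Suc m * r)) \<le> ennreal C * emeasure \<mu> (mball d x (2 ^ m * r))"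
      using C(2)[of "2 ^ m * r" x] that by (simp add: mult.assoc)
    also have "\<dots> \<le> ennreal C * (ennreal (C ^ m) * emeasure \<mu> (mball d x r))"
      by (intro mult_left_mono Suc.IH) simp
    also have "\<dots> = ennreal (C ^ Suc m) * emeasure \<mu> (mball d x r)"
      using C(1) by (simp add: mult.assoc[symmetric] ennreal_mult)
    finally show ?case .
  qed simp
  with C(1) that show thesis by blast
qed

lemma christ_cubesD:
  assumes "christ_cubes d \<mu> D"
  shows "\<forall>k. \<forall>I\<in>D k. open I"
    and "\<forall>k. disjoint (D k)"
    and "\<forall>k. UNIV - \<Union>(D k) \<in> null_sets \<mu>"
    and "\<forall>k l. l < k \<longrightarrow> (\<forall>I\<in>D k. \<exists>!J. J \<in> D l \<and> I \<subseteq> J)"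
    and "\<exists>C1>0. \<forall>k. \<forall>I\<in>D k. \<forall>x\<in>I. \<forall>y\<in>I. d x y \<le> ennreal (C1 * 2 powi (- k))"
    and "\<exists>C2>0. \<forall>k. \<forall>I\<in>D k. \<exists>z. mball d z (C2 * 2 powi (- k)) \<subseteq> I"
  using assms unfolding christ_cubes_def by - (elim conjE, assumption)+

text \<open>A cube contains a ball and, by its diameter bound, is contained in a ball; both balls
  have positive finite measure.\<close>

lemma christ_cube_bounds:
  assumes cubes: "christ_cubes d \<mu> D" and doubling: "doubling d \<mu>"
    and sets: "sets \<mu> = sets borel" and I: "I \<in> dyadic_cubes D"
  shows "I \<in> sets \<mu>" "I \<noteq> {}" "0 < emeasure \<mu> I" "emeasure \<mu> I < \<infinity>"
proof -
  from I obtain k where k: "I \<in> D k" by (auto simp: dyadic_cubes_def)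
  have "open I" using christ_cubesD(1)[OF cubes] k by blast
  then show I_sets: "I \<in> sets \<mu>" by (simp add: sets)
  obtain C2 where "C2 > 0" "\<forall>k. \<forall>I\<in>D k. \<exists>z. mball d z (C2 * 2 powi (- k)) \<subseteq> I"
    using christ_cubesD(6)[OF cubes] by blast
  with k obtain z where z: "mball d z (C2 * 2 powi (- k)) \<subseteq> I" "C2 * 2 powi (- k) > 0"
    by (metis mult_pos_pos zero_less_numeral zero_less_power_int)
  then have "0 < emeasure \<mu> (mball d z (C2 * 2 powi (- k)))"
    using doubling unfolding doubling_def by blast
  also have "\<dots> \<le> emeasure \<mu> I" using z I_sets by (intro emeasure_mono)
  finally show pos: "0 < emeasure \<mu> I" .
  then show "I \<noteq> {}" by auto
  then obtain x where x: "x \<in> I" by blast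
  obtain C1 where C1: "C1 > 0"
    "\<forall>k. \<forall>I\<in>D k. \<forall>x\<in>I. \<forall>y\<in>I. d x y \<le> ennreal (C1 * 2 powi (- k))"
    using christ_cubesD(5)[OF cubes] by blast
  \<comment> \<open>Twice the diameter bound, because the diameter bound is weak while balls are
    defined by a strict inequality.\<close>
  let ?r = "2 * (C1 * 2 powi (- k))"
  have pos_r: "C1 * 2 powi (- k) > 0" using C1 by simp
  have "I \<subseteq> mball d x ?r"
  proof
    fix y assume "y \<in> I"
    then have "d x y \<le> ennreal (C1 * 2 powi (- k))" using C1 k x by blast
    also have "\<dots> < ennreal ?r" using pos_r by (simp add: ennreal_lessI)
    finally show "y \<in> mball d x ?r" by (simp add: mball_def)
  qed
  moreover have "mball d x ?r \<in> sets \<mu>" "emeasure \<mu> (mball d x ?r) < \<infinity>"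
    using doubling pos_r unfolding doubling_def by (metis mult_pos_pos zero_less_numeral)+
  ultimately show "emeasure \<mu> I < \<infinity>"
    by (meson emeasure_mono order_le_less_trans)
qed

section \<open>Inclusions between cubes, and growth of measure along ancestors\<close>

lemma christ_cubes_unique:
  assumes "christ_cubes d \<mu> D" "I \<in> D k" "J \<in> D k" "x \<in> I" "x \<in> J"
  shows "I = J"
  using christ_cubesD(2)[OF assms(1)] assms(2-) unfolding pairwise_def disjnt_def by blast

lemma christ_cubes_ancestor:
  assumes "christ_cubes d \<mu> D" "I \<in> D k" "l \<le> k"
  obtains J where "J \<in> D l" "I \<subseteq> J"
proof (cases "l = k")
  case False
  then show thesis
    using that christ_cubesD(4)[OF assms(1)] assms(2,3) by (meson order_le_neq_trans)
qed (use assms that in auto)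

lemma christ_cubes_subset:
  assumes "christ_cubes d \<mu> D" "I \<in> D k" "J \<in> D l" "l \<le> k" "x \<in> I" "x \<in> J"
  shows "I \<subseteq> J"
proof -
  obtain J' where "J' \<in> D l" "I \<subseteq> J'" using christ_cubes_ancestor[OF assms(1,2,4)] .
  then show ?thesis using christ_cubes_unique[OF assms(1) _ assms(3), of J' x] assms by auto
qed

text \<open>
  If \<open>J\<close> is strictly contained in another cube, then it misses a point at finite distance, so the
  control metric provides points at intermediate distances. Hence \<open>J\<close> contains two balls of the size
  of \<open>I\<close> that are too far apart for both to meet \<open>I\<close>, and by doubling the one that does not meet
  \<open>I\<close> has measure comparable with that of \<open>I\<close>.
\<close>

lemma christ_cube_growth:
  fixes \<A> :: "('a::{t2_space,second_countable_topology}, 'e::euclidean_space) chart set"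
  assumes cubes: "christ_cubes (control_metric \<A> Xs) \<mu> D"
    and doubling: "doubling (control_metric \<A> Xs) \<mu>" and sets: "sets \<mu> = sets borel"
  obtains \<theta> :: real and N :: nat where "\<theta> > 1" "N > 0"
    "\<And>k I J J'. I \<in> D k \<Longrightarrow> J \<in> D (k - int N) \<Longrightarrow> I \<subseteq> J \<Longrightarrow> J' \<in> dyadic_cubes D \<Longrightarrow> J \<subset> J' \<Longrightarrow>
       \<theta> * measure \<mu> I \<le> measure \<mu> J"
proof -
  let ?d = "control_metric \<A> Xs"
  note bounds = christ_cube_bounds[OF cubes doubling sets]
  obtain C1 where C1: "C1 > 0"
    "\<And>k I x y. I \<in> D k \<Longrightarrow> x \<in> I \<Longrightarrow> y \<in> I \<Longrightarrow> ?d x y \<le> ennreal (C1 * 2 powi (- k))"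
    using christ_cubesD(5)[OF cubes] by blast
  obtain C2 where C2: "C2 > 0"
    "\<And>k I. I \<in> D k \<Longrightarrow> \<exists>z. mball ?d z (C2 * 2 powi (- k)) \<subseteq> I"
    using christ_cubesD(6)[OF cubes] by blast
  obtain C where C: "C > 0"
    "\<And>x r m. r > 0 \<Longrightarrow> emeasure \<mu> (mball ?d x (2 ^ m * r)) \<le> ennreal (C ^ m) * emeasure \<mu> (mball ?d x r)"
    by (rule doubling_iterate[OF doubling]) blast
  \<comment> \<open>With \<open>r\<close> the scale of \<open>I\<close> and \<open>S\<close> the
    inner radius of \<open>J\<close>, the choice of \<open>N\<close> gives
    \<open>(2 + C1) * r < S / 4\<close>: two balls of radius \<open>r\<close> that both meet
    \<open>I\<close> have centres closer than \<open>S / 4\<close>. The successor ensures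
    \<open>N > 0\<close>.\<close>
  obtain N0 where "4 * (2 + C1) / C2 < 2 ^ N0" using real_arch_pow[of 2] by auto
  also have "(2::real) ^ N0 \<le> 2 ^ Suc N0" by simp
  finally have "4 * (2 + C1) / C2 < 2 ^ Suc N0" .
  then obtain N where N: "N > 0" "4 * (2 + C1) < C2 * 2 ^ N"
    using C2(1) by (auto simp: field_simps intro: that[of "Suc N0"])
  \<comment> \<open>The diameter of \<open>J\<close> is at most \<open>C1 * 2 ^ N * r\<close>, so
    \<open>m\<close> doublings enlarge a ball of radius \<open>r\<close> centred in \<open>J\<close>
    to one that contains \<open>I\<close>.\<close>
  obtain m where m: "C1 * 2 ^ N < 2 ^ m" using real_arch_pow[of 2] by auto
  have balls: "mball ?d x r \<in> sets \<mu>" "emeasure \<mu> (mball ?d x r) < \<infinity>" if "r > 0" for x r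
    using doubling that unfolding doubling_def by auto
  show thesis
  \<comment> \<open>Besides \<open>I\<close>, the cube \<open>J\<close> contains a ball disjoint
    from \<open>I\<close> whose measure is at least that of \<open>I\<close> divided by
    \<open>C ^ m\<close>.\<close>
  proof (rule that[of "1 + 1 / C ^ m" N])
    show "1 + 1 / C ^ m > 1" using C(1) by simp
    fix k I J J' assume I: "I \<in> D k" and J: "J \<in> D (k - int N)" and IJ: "I \<subseteq> J"
      and J': "J' \<in> dyadic_cubes D" "J \<subset> J'"
    have dyad: "I \<in> dyadic_cubes D" "J \<in> dyadic_cubes D" using I J by (auto simp: dyadic_cubes_def)
    define r :: real where "r = 2 powi (- k)"
    have r: "r > 0" by (simp add: r_def)
    have scale: "2 powi (- (k - int N)) = 2 ^ N * r"
      unfolding r_def by (simp add: power_int_diff power_int_minus field_simps)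
    define S where "S = C2 * (2 ^ N * r)"
    have S: "S > 0" "4 * (2 + C1) * r < S"
      using C2 r N(2) by (auto simp: S_def mult.assoc[symmetric])
    obtain z where z: "mball ?d z S \<subseteq> J" using C2(2)[OF J] unfolding scale S_def by blast
    obtain y' where y': "y' \<in> J'" "y' \<notin> J" using J' by blast
    have "z \<in> J" using z S mball_control_metric_memI by blast
    \<comment> \<open>The lower bound \<open>S / 4\<close> keeps the balls around \<open>z\<close>
      and \<open>y\<close> from both meeting \<open>I\<close>; the upper bound \<open>S / 2\<close>
      leaves room for the ball around \<open>y\<close> inside the ball of radius \<open>S\<close>
      around \<open>z\<close>, hence inside \<open>J\<close>.\<close>
    obtain y where y: "ennreal (S / 4) \<le> ?d z y" "?d z y < ennreal (S / 2)"
    proof -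
      obtain l where "J' \<in> D l" using J' by (auto simp: dyadic_cubes_def)
      then have "?d z y' \<le> ennreal (C1 * 2 powi (- l))" using C1(2) y' \<open>z \<in> J\<close> J' by blast
      then have "?d z y' < \<infinity>" by (simp add: order_le_less_trans)
      moreover have "y' \<notin> mball ?d z S" using y' z by blast
      then have "ennreal S \<le> ?d z y'" by (simp add: mball_def not_less)
      then have "ennreal (S / 4) \<le> ?d z y'"
        using S by (intro order_trans[OF ennreal_leI[of "S/4" S]]) auto
      ultimately show thesis using control_metric_intermediate[of \<A> Xs z y' "S / 4"] S that by auto
    qed
    have "mball ?d y r \<subseteq> mball ?d z S"
    proof
      fix v assume "v \<in> mball ?d y r"
      then have v: "?d y v \<le> ennreal r" by (simp add: mball_def)
      have "?d z v \<le> ?d z y + ?d y v" by (rule control_metric_triangle)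
      also have "\<dots> \<le> ennreal (S / 2) + ennreal r" using y v by (intro add_mono) auto
      also have "\<dots> = ennreal (S / 2 + r)" using S r by (simp add: ennreal_plus)
      also have "\<dots> < ennreal S"
      proof (rule ennreal_lessI)
        have "8 * r \<le> 4 * (2 + C1) * r" using C1 r by (simp add: mult_right_mono)
        then show "S / 2 + r < S" using S r by linarith
      qed (rule S)
      finally show "v \<in> mball ?d z S" by (simp add: mball_def)
    qed
    moreover have "mball ?d z r \<subseteq> mball ?d z S"
    proof -
      have "1 * r \<le> 4 * (2 + C1) * r" using C1 r by (intro mult_right_mono) auto
      then have "r \<le> S" using S by linarith
      then show ?thesis unfolding mball_def by (auto intro: order_less_le_trans ennreal_leI)
    qed
    moreover have "mball ?d z r \<inter> I = {} \<or> mball ?d y r \<inter> I = {}"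
    proof (rule ccontr)
      assume "\<not> ?thesis"
      then obtain a b where ab: "a \<in> I" "b \<in> I" "?d z a < ennreal r" "?d y b < ennreal r"
        by (auto simp: mball_def)
      have "?d z y \<le> ?d z b + ?d b y" by (rule control_metric_triangle)
      also have "\<dots> \<le> (?d z a + ?d a b) + ?d y b"
        by (intro add_mono control_metric_triangle) (simp add: control_metric_sym)
      also have "\<dots> \<le> (ennreal r + ennreal (C1 * r)) + ennreal r"
        using ab C1(2)[OF I] by (intro add_mono) (auto simp: r_def)
      also have "\<dots> = ennreal ((2 + C1) * r)"
        using r C1 by (simp add: algebra_simps flip: ennreal_plus)
      also have "\<dots> < ennreal (S / 4)" using S by (intro ennreal_lessI) (simp_all add: algebra_simps)
      finally show False using y by simp
    qed
    ultimately obtain p where p: "mball ?d p r \<subseteq> J" "mball ?d p r \<inter> I = {}" using z by blast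
    let ?B = "mball ?d p r"
    have "p \<in> J" using p r mball_control_metric_memI by blast
    have "I \<subseteq> mball ?d p (2 ^ m * r)"
    proof
      fix x assume "x \<in> I"
      then have "?d p x \<le> ennreal (C1 * (2 ^ N * r))"
        using C1(2)[OF J \<open>p \<in> J\<close>, of x] IJ \<open>x \<in> I\<close> unfolding scale by blast
      also have "\<dots> < ennreal (2 ^ m * r)"
        using m r by (intro ennreal_lessI) (auto simp: mult.assoc[symmetric])
      finally show "x \<in> mball ?d p (2 ^ m * r)" by (simp add: mball_def)
    qed
    then have "emeasure \<mu> I \<le> emeasure \<mu> (mball ?d p (2 ^ m * r))"
      using balls r by (intro emeasure_mono) auto
    also have "\<dots> \<le> ennreal (C ^ m) * emeasure \<mu> ?B" using C(2) r .
    finally have "measure \<mu> I \<le> C ^ m * measure \<mu> ?B"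
      using balls[OF r, of p] bounds(4)[OF dyad(1)] C(1)
      by (simp add: emeasure_eq_ennreal_measure flip: ennreal_mult)
    then have "(1 + 1 / C ^ m) * measure \<mu> I \<le> measure \<mu> I + measure \<mu> ?B"
      using C(1) by (simp add: field_simps)
    also have "\<dots> = measure \<mu> (I \<union> ?B)"
      using bounds[OF dyad(1)] balls[OF r, of p] p by (intro measure_Union[symmetric]) auto
    also have "\<dots> \<le> measure \<mu> J"
      using bounds[OF dyad(1)] bounds[OF dyad(2)] balls[OF r, of p] p IJ
      by (intro measure_mono_fmeasurable) (auto simp: fmeasurable_def)
    finally show "(1 + 1 / C ^ m) * measure \<mu> I \<le> measure \<mu> J" .
  qed (rule N)
qed

text \<open>The substance is the chain bound. Growth applies only to cubes with a strict superset,
  so a chain is split into these cubes, counted by generation, and the remaining maximal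
  ones.\<close>

lemma christ_cubes_dyadic_system:
  fixes \<A> :: "('a::{t2_space,second_countable_topology}, 'e::euclidean_space) chart set"
  assumes cubes: "christ_cubes (control_metric \<A> Xs) \<mu> D"
    and doubling: "doubling (control_metric \<A> Xs) \<mu>" and sets: "sets \<mu> = sets borel"
  obtains K where "dyadic_system \<mu> D K"
proof -
  note bounds = christ_cube_bounds[OF cubes doubling sets]
  obtain \<theta> N where \<theta>: "\<theta> > 1" and N: "N > 0" and growth:
    "\<And>k I J J'. I \<in> D k \<Longrightarrow> J \<in> D (k - int N) \<Longrightarrow> I \<subseteq> J \<Longrightarrow> J' \<in> dyadic_cubes D \<Longrightarrow> J \<subset> J' \<Longrightarrow>
       \<theta> * measure \<mu> I \<le> measure \<mu> J"
    using christ_cube_growth[OF cubes doubling sets] by metis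
  have growth_n: "\<theta> ^ n * measure \<mu> I \<le> measure \<mu> J"
    if "I \<in> D k" "J \<in> D (k - int (N * n))" "I \<subseteq> J" "J' \<in> dyadic_cubes D" "J \<subset> J'"
    for n k I J J'
    using that
  proof (induction n arbitrary: J)
    case 0
    obtain x where "x \<in> I" using bounds(2)[of I] 0 by (auto simp: dyadic_cubes_def)
    then have "I = J" using christ_cubes_unique[OF cubes, of I k J x] 0 by auto
    then show ?case by simp
  next
    case (Suc n)
    obtain x where x: "x \<in> I" using bounds(2)[of I] Suc.prems by (auto simp: dyadic_cubes_def)
    obtain I' where I': "I' \<in> D (k - int (N * n))" "I \<subseteq> I'"
      using christ_cubes_ancestor[OF cubes Suc.prems(1), of "k - int (N * n)"] by auto
    have J: "J \<in> D (k - int (N * n) - int N)" using Suc.prems(2) by (simp add: algebra_simps)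
    have I'J: "I' \<subseteq> J"
      by (rule christ_cubes_subset[OF cubes I'(1) J, of x]) (use x I' Suc.prems in auto)
    \<comment> \<open>The strict superset \<open>J'\<close> of the last cube also serves for every
      cube in between.\<close>
    then have "I' \<subset> J'" using Suc.prems by blast
    have "\<theta> ^ Suc n * measure \<mu> I = \<theta> * (\<theta> ^ n * measure \<mu> I)" by simp
    also have "\<dots> \<le> \<theta> * measure \<mu> I'"
      using Suc.IH[OF Suc.prems(1) I' Suc.prems(4) \<open>I' \<subset> J'\<close>] \<theta> by (intro mult_left_mono) auto
    also have "\<dots> \<le> measure \<mu> J" using growth[OF I'(1) J I'J Suc.prems(4,5)] .
    finally show ?case .
  qed
  \<comment> \<open>Climbing \<open>N * P\<close> generations thus more than doubles the measure, as
    long as a strict superset remains.\<close>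
  obtain P where P: "2 < \<theta> ^ P" using real_arch_pow[OF \<theta>] by auto
  have nested: "I \<subseteq> J \<or> J \<subseteq> I \<or> I \<inter> J = {}"
    if "I \<in> dyadic_cubes D" "J \<in> dyadic_cubes D" for I J
  proof -
    from that obtain k l where "I \<in> D k" "J \<in> D l" by (auto simp: dyadic_cubes_def)
    then show ?thesis
      using christ_cubes_subset[OF cubes, of I k J l] christ_cubes_subset[OF cubes, of J l I k]
      by (metis disjoint_iff linorder_le_cases)
  qed
  have card_chain: "card \<C> \<le> (N * P + 1) * Suc j"
    if fin: "finite \<C>" and sub: "\<C> \<subseteq> dyadic_cubes D" and x: "x \<in> \<Inter>\<C>"
      and ratio: "\<And>I J. I \<in> \<C> \<Longrightarrow> J \<in> \<C> \<Longrightarrow> I \<subseteq> J \<Longrightarrow> measure \<mu> J < 2 ^ Suc j * measure \<mu> I"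
    for \<C> x j
  proof -
    define \<C>' where "\<C>' = {J\<in>\<C>. \<exists>J'\<in>dyadic_cubes D. J \<subset> J'}"
    define L where "L = N * (P * Suc j)"
    have "\<forall>J\<in>\<C>. \<exists>k. J \<in> D k" using sub by (auto simp: dyadic_cubes_def)
    \<comment> \<open>A set may belong to several generations; \<open>g\<close> selects one.
      Distinct cubes around \<open>x\<close> receive distinct values because each generation is
      disjoint.\<close>
    then obtain g where g: "\<And>J. J \<in> \<C> \<Longrightarrow> J \<in> D (g J)" by metis
    have "inj_on g \<C>'"
    proof (rule inj_onI)
      fix I J assume "I \<in> \<C>'" "J \<in> \<C>'" "g I = g J"
      then show "I = J"
        using christ_cubes_unique[OF cubes, of I "g I" J x] g[of I] g[of J] x by (auto simp: \<C>'_def)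
    qed
    then have "card \<C>' = card (g ` \<C>')" by (simp add: card_image)
    also have "\<dots> \<le> L"
    proof (cases "\<C>' = {}")
      case False
      have fin': "finite (g ` \<C>')" "g ` \<C>' \<noteq> {}" using fin False by (auto simp: \<C>'_def)
      \<comment> \<open>\<open>J\<close> is the coarsest member. For a member \<open>I\<close> at
        least \<open>L\<close> generations finer, the ancestor of \<open>I\<close> that lies
        \<open>L\<close> generations up would still be inside \<open>J\<close>, and growth would
        force \<open>2 ^ Suc j * measure \<mu> I \<le> measure \<mu> J\<close>, against
        \<open>ratio\<close>. So all generations fit into an interval of length
        \<open>L\<close>.\<close>
      obtain J where J: "J \<in> \<C>'" "g J = Min (g ` \<C>')" using Min_in[OF fin'] by auto
      have lt: "g I < g J + int L" if "I \<in> \<C>'" for I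
      proof (rule ccontr)
        assume "\<not> g I < g J + int L"
        then have le: "g J \<le> g I - int L" by simp
        have I: "I \<in> D (g I)" "x \<in> I" "I \<in> \<C>" using that g x by (auto simp: \<C>'_def)
        have "J \<in> \<C>" using J(1) by (auto simp: \<C>'_def)
        then have J'': "J \<in> D (g J)" "x \<in> J" "J \<in> \<C>" using g[of J] x by blast+
        obtain I' where I': "I' \<in> D (g I - int L)" "I \<subseteq> I'"
          using christ_cubes_ancestor[OF cubes I(1), of "g I - int L"] by auto
        have I'J: "I' \<subseteq> J"
          by (rule christ_cubes_subset[OF cubes I'(1) J''(1) le, of x]) (use I I' J'' in auto)
        obtain J' where J': "J' \<in> dyadic_cubes D" "J \<subset> J'" using J by (auto simp: \<C>'_def)
        have "2 ^ Suc j * measure \<mu> I \<le> (\<theta> ^ P) ^ Suc j * measure \<mu> I"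
          using P by (intro mult_right_mono power_mono) auto
        also have "\<dots> = \<theta> ^ (P * Suc j) * measure \<mu> I" by (simp only: power_mult)
        also have "\<dots> \<le> measure \<mu> I'"
          using growth_n[OF I(1) I'(1)[unfolded L_def] I'(2) J'(1)] I'J J' by auto
        also have "\<dots> \<le> measure \<mu> J"
        proof (rule measure_mono_fmeasurable[OF I'J])
          have "I' \<in> dyadic_cubes D" "J \<in> dyadic_cubes D"
            using I'(1) J''(1) by (auto simp: dyadic_cubes_def)
          then show "I' \<in> sets \<mu>" "J \<in> fmeasurable \<mu>" using bounds by (auto simp: fmeasurable_def)
        qed
        finally show False using ratio[OF I(3) J''(3)] I' I'J by auto
      qed
      have "g ` \<C>' \<subseteq> {g J..<g J + int L}" using lt J fin' by auto
      then have "card (g ` \<C>') \<le> card {g J..<g J + int L}" by (intro card_mono) auto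
      then show ?thesis by simp
    qed simp
    finally have card': "card \<C>' \<le> L" .
    \<comment> \<open>Two cubes without strict supercubes that share \<open>x\<close> are nested and
      hence equal. This single extra cube accounts for the summand 1 in
      \<open>N * P + 1\<close>.\<close>
    have "I = J" if I: "I \<in> \<C> - \<C>'" and J: "J \<in> \<C> - \<C>'" for I J
    proof -
      have dyad: "I \<in> dyadic_cubes D" "J \<in> dyadic_cubes D" using I J sub by blast+
      then have "\<not> I \<subset> J" "\<not> J \<subset> I" using I J unfolding \<C>'_def by blast+
      moreover have "x \<in> I \<inter> J" using I J x by blast
      ultimately show "I = J" using nested[OF dyad] by blast
    qed
    then have "card (\<C> - \<C>') \<le> Suc 0" using fin by (subst card_le_Suc0_iff_eq) auto
    moreover have "\<C>' \<union> (\<C> - \<C>') = \<C>" by (auto simp: \<C>'_def)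
    then have "card \<C> \<le> card \<C>' + card (\<C> - \<C>')" using card_Un_le[of \<C>' "\<C> - \<C>'"] by simp
    ultimately have "card \<C> \<le> L + 1" using card' by simp
    also have "\<dots> \<le> (N * P + 1) * Suc j" by (simp add: L_def algebra_simps)
    finally show ?thesis .
  qed
  show thesis
  proof (rule that[of "N * P + 1"], unfold_locales)
    show "sets \<mu> = sets borel" by (rule sets)
    have D0: "I \<in> dyadic_cubes D" if "I \<in> D 0" for I using that by (auto simp: dyadic_cubes_def)
    \<comment> \<open>For sigma-finiteness: one generation consists of disjoint open sets of finite
      measure, countably many by second countability, and misses only a null set.\<close>
    have "countable (D 0)" using christ_cubesD(1,2)[OF cubes] by (intro countable_disjoint_open_subsets) auto
    have "UNIV - \<Union>(D 0) \<in> null_sets \<mu>" using christ_cubesD(3)[OF cubes] by blast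
    then have null0: "UNIV - \<Union>(D 0) \<in> sets \<mu>" "emeasure \<mu> (UNIV - \<Union>(D 0)) = 0" by auto
    have "space \<mu> = UNIV" using sets_eq_imp_space_eq[OF sets] by simp
    show "\<exists>A. countable A \<and> A \<subseteq> sets \<mu> \<and> \<Union>A = space \<mu> \<and> (\<forall>a\<in>A. emeasure \<mu> a \<noteq> \<infinity>)"
    proof (intro exI conjI ballI)
      show "countable (insert (UNIV - \<Union>(D 0)) (D 0))" using \<open>countable (D 0)\<close> by simp
      show "insert (UNIV - \<Union>(D 0)) (D 0) \<subseteq> sets \<mu>" using null0(1) bounds(1)[OF D0] by blast
      show "\<Union>(insert (UNIV - \<Union>(D 0)) (D 0)) = space \<mu>" using \<open>space \<mu> = UNIV\<close> by blast
      fix a assume "a \<in> insert (UNIV - \<Union>(D 0)) (D 0)"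
      then have "a = UNIV - \<Union>(D 0) \<or> a \<in> D 0" by blast
      then show "emeasure \<mu> a \<noteq> \<infinity>"
        using null0(2) bounds(4)[OF D0, of a] by (elim disjE) auto
    qed
    show "open I" if "I \<in> dyadic_cubes D" for I
      using that christ_cubesD(1)[OF cubes] by (auto simp: dyadic_cubes_def)
    show "0 < emeasure \<mu> I" "emeasure \<mu> I < \<infinity>" if "I \<in> dyadic_cubes D" for I using bounds that by auto
    show "I \<subseteq> J \<or> J \<subseteq> I \<or> I \<inter> J = {}" if "I \<in> dyadic_cubes D" "J \<in> dyadic_cubes D" for I J
      using nested[OF that] .
  qed (fact card_chain)
qed


section \<open>Journe's covering argument\<close>

text \<open>The left side is the integral of the number of sets \<open>A i\<close> that contain a
  point, and this number is at most \<open>n\<close> on \<Omega> and zero elsewhere.\<close>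

lemma sum_measure_le_overlap:
  assumes F: "finite F" and A: "\<And>i. i \<in> F \<Longrightarrow> A i \<in> sets M" "\<And>i. i \<in> F \<Longrightarrow> A i \<subseteq> \<Omega>"
    and \<Omega>: "\<Omega> \<in> sets M" "emeasure M \<Omega> < \<infinity>"
    and overlap: "\<And>x. card {i\<in>F. x \<in> A i} \<le> n"
  shows "(\<Sum>i\<in>F. measure M (A i)) \<le> real n * measure M \<Omega>"
proof -
  have fin: "emeasure M (A i) < \<infinity>" if "i \<in> F" for i
    using emeasure_mono[OF A(2)[OF that] \<Omega>(1)] \<Omega>(2) by (rule order_le_less_trans)
  have "ennreal (\<Sum>i\<in>F. measure M (A i)) = (\<Sum>i\<in>F. emeasure M (A i))"
    using fin by (subst sum_ennreal[symmetric]) (auto intro!: sum.cong simp: emeasure_eq_ennreal_measure less_top)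
  also have "\<dots> = (\<integral>\<^sup>+x. (\<Sum>i\<in>F. indicator (A i) x) \<partial>M)"
    using A(1) by (subst nn_integral_sum) auto
  also have "\<dots> \<le> (\<integral>\<^sup>+x. ennreal (real n) * indicator \<Omega> x \<partial>M)"
  proof (rule nn_integral_mono)
    fix x
    have "(\<Sum>i\<in>F. indicator (A i) x) = (of_nat (card {i\<in>F. x \<in> A i}) :: ennreal)"
      using F by (simp add: indicator_def sum.If_cases Int_def)
    also have "\<dots> \<le> ennreal (real n) * indicator \<Omega> x"
    proof (cases "x \<in> \<Omega>")
      case True
      then show ?thesis using overlap[of x] by (simp add: ennreal_of_nat_eq_real_of_nat)
    next
      case False
      then have "{i\<in>F. x \<in> A i} = {}" using A(2) by blast
      then have "card {i\<in>F. x \<in> A i} = 0" by (simp only: card.empty)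
      then show ?thesis by simp
    qed
    finally show "(\<Sum>i\<in>F. indicator (A i) x) \<le> ennreal (real n) * indicator \<Omega> x" .
  qed
  also have "\<dots> = ennreal (real n * measure M \<Omega>)"
    using \<Omega> by (simp add: nn_integral_cmult_indicator emeasure_eq_ennreal_measure ennreal_mult)
  finally show ?thesis by (simp add: ennreal_le_iff)
qed

lemma dyadic_scale:
  fixes a :: real
  assumes "0 < a" "a \<le> 1"
  obtains j :: nat where "1 / 2 ^ Suc j < a" "a \<le> 1 / 2 ^ j"
proof -
  obtain n0 where n0: "(1 / 2) ^ n0 < a" using real_arch_pow_inv[OF assms(1), of "1/2"] by auto
  define n where "n = (LEAST n. (1 / 2) ^ n < a)"
  have n: "(1 / 2) ^ n < a" unfolding n_def using n0 by (rule LeastI)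
  with assms have "n \<noteq> 0" by (cases n) auto
  then obtain j where j: "n = Suc j" using not0_implies_Suc by blast
  then have "\<not> (1 / 2) ^ j < a" using not_less_Least[of j "\<lambda>n. (1 / 2) ^ n < a"] by (simp add: n_def)
  with n j that show thesis by (simp add: power_one_over)
qed

section \<open>Supercubes of a cube in a single factor\<close>

context dyadic_system
begin

lemma space_M: "space M = UNIV"
  using sets_eq_imp_space_eq[OF sets_M] by simp

lemma cube_sets: "I \<in> dyadic_cubes D \<Longrightarrow> I \<in> sets M"
  using open_cube by (simp add: sets_M)

lemma cube_fmeasurable: "I \<in> dyadic_cubes D \<Longrightarrow> I \<in> fmeasurable M"
  using cube_sets emeasure_cube_finite by (simp add: fmeasurable_def)

lemma measure_cube_pos: "I \<in> dyadic_cubes D \<Longrightarrow> 0 < measure M I"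
  using emeasure_cube_pos emeasure_cube_finite
  by (simp add: measure_def enn2real_positive_iff less_top)

lemma cube_nonempty: "I \<in> dyadic_cubes D \<Longrightarrow> I \<noteq> {}"
  using measure_cube_pos by force

lemma measure_cube_mono: "I \<in> dyadic_cubes D \<Longrightarrow> J \<in> dyadic_cubes D \<Longrightarrow> I \<subseteq> J \<Longrightarrow> measure M I \<le> measure M J"
  by (intro measure_mono_fmeasurable cube_sets cube_fmeasurable)

lemma supercubes_linear:
  assumes "I \<in> dyadic_cubes D" "J \<in> dyadic_cubes D" "J' \<in> dyadic_cubes D" "I \<subseteq> J" "I \<subseteq> J'"
  shows "J \<subseteq> J' \<or> J' \<subseteq> J"
  using nested[OF assms(2,3)] cube_nonempty[OF assms(1)] assms(4,5) by blast

text \<open>All these supercubes have measure between that of \<open>I\<close> and \<open>B\<close>,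
  so the chain bound limits the size of every finite subfamily by one constant.\<close>

lemma finite_bounded_supercubes:
  assumes I: "I \<in> dyadic_cubes D"
  shows "finite {J \<in> dyadic_cubes D. I \<subseteq> J \<and> measure M J \<le> B}"
proof -
  obtain x where x: "x \<in> I" using cube_nonempty[OF I] by blast
  have pos: "0 < measure M I" using measure_cube_pos[OF I] .
  obtain j where "B / measure M I < 2 ^ j" using real_arch_pow[of 2] by auto
  also have "(2::real) ^ j \<le> 2 ^ Suc j" by simp
  finally have j: "B < 2 ^ Suc j * measure M I" using pos by (simp add: field_simps)
  show ?thesis
  proof (rule finite_if_finite_subsets_card_bdd[of _ "K * Suc j", THEN conjunct1], rule card_chain_le)
    fix \<C> assume \<C>: "\<C> \<subseteq> {J \<in> dyadic_cubes D. I \<subseteq> J \<and> measure M J \<le> B}"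
    then show "\<C> \<subseteq> dyadic_cubes D" "x \<in> \<Inter>\<C>" using x by auto
    fix J J' assume "J \<in> \<C>" "J' \<in> \<C>"
    then have J: "J \<in> dyadic_cubes D" "I \<subseteq> J" "measure M J' \<le> B" using \<C> by auto
    then have "measure M I \<le> measure M J" using I measure_cube_mono by blast
    then have "2 ^ Suc j * measure M I \<le> 2 ^ Suc j * measure M J" by (intro mult_left_mono) auto
    then show "measure M J' < 2 ^ Suc j * measure M J" using J j by linarith
  qed
qed

text \<open>\<open>GREATEST\<close> says something only if a greatest element exists. The candidates
  are linearly ordered, and the measure bound makes them finite in number, so a maximal one is
  greatest.\<close>

lemma greatest_supercube:
  assumes I: "I \<in> dyadic_cubes D" "P I"
    and bdd: "\<And>J. J \<in> dyadic_cubes D \<Longrightarrow> I \<subseteq> J \<Longrightarrow> P J \<Longrightarrow> measure M J \<le> B"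
  defines "H \<equiv> GREATEST J. J \<in> dyadic_cubes D \<and> I \<subseteq> J \<and> P J"
  shows "H \<in> dyadic_cubes D" "I \<subseteq> H" "\<And>J. J \<in> dyadic_cubes D \<Longrightarrow> I \<subseteq> J \<Longrightarrow> P J \<Longrightarrow> J \<subseteq> H"
proof -
  let ?S = "{J. J \<in> dyadic_cubes D \<and> I \<subseteq> J \<and> P J}"
  have fin: "finite ?S"
    using bdd by (intro finite_subset[OF _ finite_bounded_supercubes[OF I(1), of B]]) auto
  have ne: "?S \<noteq> {}" using I by auto
  from finite_has_maximal[OF fin ne] obtain G where G: "G \<in> ?S" "\<forall>J\<in>?S. G \<subseteq> J \<longrightarrow> G = J" ..
  have le: "J \<subseteq> G" if J: "J \<in> dyadic_cubes D" "I \<subseteq> J" "P J" for J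
  proof -
    have "J \<subseteq> G \<or> G \<subseteq> J" using supercubes_linear[OF I(1) J(1) _ J(2), of G] G(1) by simp
    moreover have "G \<subseteq> J \<longrightarrow> G = J" using bspec[OF G(2), of J] J by simp
    ultimately show ?thesis by blast
  qed
  have "H = G" unfolding H_def using G(1) le by (intro Greatest_equality) auto
  with G(1) le show "H \<in> dyadic_cubes D" "I \<subseteq> H"
    "\<And>J. J \<in> dyadic_cubes D \<Longrightarrow> I \<subseteq> J \<Longrightarrow> P J \<Longrightarrow> J \<subseteq> H" by auto
qed

text \<open>The cutoff at the measure of \<open>J1\<close> makes the candidates finite. It loses
  nothing: any competitor inside a candidate has smaller or equal measure and passes the cutoff as
  well.\<close>

lemma smallest_large_supercube:
  assumes I: "I \<in> dyadic_cubes D" and J1: "J1 \<in> dyadic_cubes D" "I \<subseteq> J1" "b \<le> measure M J1"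
  obtains J0 where "J0 \<in> dyadic_cubes D" "I \<subseteq> J0" "b \<le> measure M J0"
    "\<And>J. J \<in> dyadic_cubes D \<Longrightarrow> I \<subseteq> J \<Longrightarrow> b \<le> measure M J \<Longrightarrow> J0 \<subseteq> J"
proof -
  let ?S = "{J \<in> dyadic_cubes D. I \<subseteq> J \<and> b \<le> measure M J \<and> measure M J \<le> measure M J1}"
  have fin: "finite ?S"
    by (rule finite_subset[OF _ finite_bounded_supercubes[OF I, of "measure M J1"]]) auto
  have ne: "?S \<noteq> {}" using J1 by auto
  from finite_has_minimal[OF fin ne]
  obtain J0 where J0: "J0 \<in> ?S" "\<forall>J\<in>?S. J \<subseteq> J0 \<longrightarrow> J0 = J" ..
  show thesis
  proof (rule that[of J0])
    fix J assume J: "J \<in> dyadic_cubes D" "I \<subseteq> J" "b \<le> measure M J"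
    have "J0 \<subseteq> J \<or> J \<subseteq> J0" using supercubes_linear[OF I _ J(1) _ J(2), of J0] J0(1) by simp
    moreover have "J0 = J" if "J \<subseteq> J0"
    proof -
      have "measure M J \<le> measure M J0" using measure_cube_mono[OF J(1) _ that] J0(1) by simp
      then have "J \<in> ?S" using J J0(1) by simp
      then show ?thesis using J0(2) that by simp
    qed
    ultimately show "J0 \<subseteq> J" by blast
  qed (use J0(1) in auto)
qed

end

section \<open>Rectangles in the product and their enlargements\<close>

locale dyadic_product = fst: dyadic_system M1 D1 K1 + snd: dyadic_system M2 D2 K2
  for M1 :: "'a::second_countable_topology measure" and D1 K1
    and M2 :: "'b::second_countable_topology measure" and D2 K2
begin

sublocale pair_sigma_finite M1 M2
  by (intro pair_sigma_finite.intro fst.sigma_finite_M snd.sigma_finite_M)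

lemma sets_open: "open \<Omega> \<Longrightarrow> \<Omega> \<in> sets (M1 \<Otimes>\<^sub>M M2)"
  using sets_pair_measure_cong[OF fst.sets_M snd.sets_M] unfolding borel_prod by simp

lemma measure_Times:
  assumes "A \<in> sets M1" "B \<in> sets M2"
  shows "measure (M1 \<Otimes>\<^sub>M M2) (A \<times> B) = measure M1 A * measure M2 B"
  using assms by (simp add: measure_def M2.emeasure_pair_measure_Times enn2real_mult)

context
  fixes \<Omega> :: "('a \<times> 'b) set"
  assumes open_\<Omega>: "open \<Omega>" and finite_\<Omega>: "emeasure (M1 \<Otimes>\<^sub>M M2) \<Omega> < \<infinity>"
begin

abbreviation (input) "M \<equiv> M1 \<Otimes>\<^sub>M M2"
abbreviation (input) "\<R> \<equiv> max_rectangles_1 D1 D2 \<Omega>"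
abbreviation (input) "hat \<equiv> hat_2 D2 M \<Omega>"

lemma \<Omega>_sets: "\<Omega> \<in> sets M"
  using sets_open[OF open_\<Omega>] .

lemma \<Omega>_fmeasurable: "\<Omega> \<in> fmeasurable M"
  using \<Omega>_sets finite_\<Omega> by (simp add: fmeasurable_def)

text \<open>The greatest cube exists: \<open>I2\<close> itself qualifies because
  \<open>I1 \<times> I2\<close> lies in \<Omega> and has positive measure, and any \<open>J\<close>
  that qualifies satisfies \<open>measure M1 I1 * measure M2 J \<le> 2 * measure M \<Omega>\<close>,
  which bounds its size.\<close>

lemma hat_properties:
  assumes R: "(I1, I2) \<in> \<R>"
  shows "hat I1 I2 \<in> dyadic_cubes D2" "I2 \<subseteq> hat I1 I2"
    "\<And>J. J \<in> dyadic_cubes D2 \<Longrightarrow> I2 \<subseteq> J \<Longrightarrow>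
       1/2 * measure M (I1 \<times> J) < measure M ((I1 \<times> J) \<inter> \<Omega>) \<Longrightarrow> J \<subseteq> hat I1 I2"
proof -
  have I1: "I1 \<in> dyadic_cubes D1" and I2: "I2 \<in> dyadic_cubes D2" and sub: "I1 \<times> I2 \<subseteq> \<Omega>"
    using R by (auto simp: max_rectangles_1_def)
  let ?P = "\<lambda>J. measure M ((I1 \<times> J) \<inter> \<Omega>) > 1/2 * measure M (I1 \<times> J)"
  have pos: "0 < measure M1 I1" "0 < measure M2 I2"
    using fst.measure_cube_pos[OF I1] snd.measure_cube_pos[OF I2] .
  have P: "?P I2"
    using pos sub fst.cube_sets[OF I1] snd.cube_sets[OF I2] by (simp add: Int_absorb2 measure_Times)
  have bdd: "measure M2 J \<le> 2 * measure M \<Omega> / measure M1 I1"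
    if "J \<in> dyadic_cubes D2" "I2 \<subseteq> J" "?P J" for J
  proof -
    have "measure M ((I1 \<times> J) \<inter> \<Omega>) \<le> measure M \<Omega>"
      using fst.cube_sets[OF I1] snd.cube_sets[OF that(1)] \<Omega>_sets \<Omega>_fmeasurable
      by (intro measure_mono_fmeasurable) auto
    then have "measure M1 I1 * measure M2 J \<le> 2 * measure M \<Omega>"
      using that(3) fst.cube_sets[OF I1] snd.cube_sets[OF that(1)] by (simp add: measure_Times)
    then show ?thesis using pos by (simp add: field_simps)
  qed
  note * = snd.greatest_supercube[where P = ?P, OF I2 P bdd]
  show "hat I1 I2 \<in> dyadic_cubes D2" "I2 \<subseteq> hat I1 I2"
    "\<And>J. J \<in> dyadic_cubes D2 \<Longrightarrow> I2 \<subseteq> J \<Longrightarrow> ?P J \<Longrightarrow> J \<subseteq> hat I1 I2"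
    unfolding hat_2_def using * by blast+
qed

text \<open>
  This is \<open>E\<^sub>J\<close> in Journe's argument, for the smallest \<open>J\<close> satisfying the measure condition. Cubes are
  compared by measure, not by generation, since several generations may contain the same set.
\<close>

definition persistent :: "nat \<Rightarrow> 'b set \<Rightarrow> 'a set" where
  "persistent j I2 = \<Union>{I1 \<in> dyadic_cubes D1. \<exists>J\<in>dyadic_cubes D2. I2 \<subseteq> J \<and>
     2 ^ Suc j * measure M2 I2 \<le> measure M2 J \<and> I1 \<times> J \<subseteq> \<Omega>}"

lemma persistent_sets: "persistent j I2 \<in> sets M1"
proof -
  have "open (persistent j I2)" unfolding persistent_def using fst.open_cube by auto
  then show ?thesis by (simp add: fst.sets_M)
qed

lemma half_not_persistent:
  assumes R: "(I1, I2) \<in> \<R>" and large: "measure M2 (hat I1 I2) < 2 ^ Suc j * measure M2 I2"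
  shows "measure M1 I1 \<le> 2 * measure M1 (I1 - persistent j I2)"
proof (cases "\<exists>J\<in>dyadic_cubes D2. I2 \<subseteq> J \<and> 2 ^ Suc j * measure M2 I2 \<le> measure M2 J")
  \<comment> \<open>The cubes above \<open>I2\<close> may stop growing before they reach this
    measure, as on a compact space; then nothing is persistent.\<close>
  case False
  then have "persistent j I2 = {}" unfolding persistent_def by blast
  then show ?thesis by simp
next
  case True
  have I1: "I1 \<in> dyadic_cubes D1" and I2: "I2 \<in> dyadic_cubes D2"
    using R by (auto simp: max_rectangles_1_def)
  from True obtain J0 where J0: "J0 \<in> dyadic_cubes D2" "I2 \<subseteq> J0"
    "2 ^ Suc j * measure M2 I2 \<le> measure M2 J0"
    and least: "\<And>J. J \<in> dyadic_cubes D2 \<Longrightarrow> I2 \<subseteq> J \<Longrightarrow> 2 ^ Suc j * measure M2 I2 \<le> measure M2 J \<Longrightarrow> J0 \<subseteq> J"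
    using snd.smallest_large_supercube[OF I2] by metis
  let ?U = "persistent j I2"
  have "\<not> J0 \<subseteq> hat I1 I2"
    using snd.measure_cube_mono[OF J0(1) hat_properties(1)[OF R]] large J0(3) by linarith
  then have not_half: "measure M ((I1 \<times> J0) \<inter> \<Omega>) \<le> 1/2 * measure M (I1 \<times> J0)"
    using hat_properties(3)[OF R J0(1,2)] by linarith
  have meas: "I1 \<in> sets M1" "J0 \<in> sets M2" "I1 \<inter> ?U \<in> sets M1"
    using fst.cube_sets[OF I1] snd.cube_sets[OF J0(1)] persistent_sets by auto
  \<comment> \<open>Every witness \<open>J\<close> in the definition of \<open>persistent\<close>
    contains the smallest cube \<open>J0\<close>, so \<Omega> contains the whole strip over the
    persistent part of \<open>I1\<close>. Since at most half of \<open>I1 \<times> J0\<close> lies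
    in \<Omega>, that part is at most half of \<open>I1\<close>.\<close>
  have "(I1 \<inter> ?U) \<times> J0 \<subseteq> (I1 \<times> J0) \<inter> \<Omega>"
    unfolding persistent_def using least by fast
  then have "measure M ((I1 \<inter> ?U) \<times> J0) \<le> measure M ((I1 \<times> J0) \<inter> \<Omega>)"
    using meas \<Omega>_sets \<Omega>_fmeasurable
    by (intro measure_mono_fmeasurable) (auto intro: fmeasurable_Int_fmeasurable simp: Int_commute)
  with not_half have "measure M1 (I1 \<inter> ?U) * measure M2 J0 \<le> (1/2 * measure M1 I1) * measure M2 J0"
    using meas by (simp add: measure_Times)
  then have "measure M1 (I1 \<inter> ?U) \<le> 1/2 * measure M1 I1"
    using snd.measure_cube_pos[OF J0(1)] by (simp only: mult_le_cancel_right_pos)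
  moreover have "measure M1 (I1 - ?U) = measure M1 I1 - measure M1 (I1 \<inter> ?U)"
    using fst.cube_fmeasurable[OF I1] meas persistent_sets[of j I2]
    by (subst measure_Diff[symmetric]) (auto simp: fmeasurable_def Diff_Int_distrib2 intro: arg_cong[where f = "measure M1"])
  ultimately show ?thesis by simp
qed

text \<open>Rectangles counted at \<open>x\<close> are determined by their second factor: first
  factors over the same \<open>I2\<close> share \<open>fst x\<close>, hence are nested, hence equal
  by maximality. The second factors all contain \<open>snd x\<close>; if one of them,
  \<open>J\<close>, contained another, \<open>I\<close>, and had at least \<open>2 ^ Suc j\<close>
  times its measure, then the rectangle over \<open>J\<close> would make \<open>fst x\<close>
  persistent for \<open>I\<close>.\<close>

lemma not_persistent_overlap:
  assumes F: "finite F" "F \<subseteq> \<R>"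
  shows "card {R\<in>F. x \<in> (fst R - persistent j (snd R)) \<times> snd R} \<le> K2 * Suc j"
proof -
  define G where "G = {R\<in>F. x \<in> (fst R - persistent j (snd R)) \<times> snd R}"
  have cubes: "I1 \<in> dyadic_cubes D1" "I2 \<in> dyadic_cubes D2" "I1 \<times> I2 \<subseteq> \<Omega>"
    and x: "fst x \<in> I1" "fst x \<notin> persistent j I2" "snd x \<in> I2"
    and maximal: "\<And>J. J \<in> dyadic_cubes D1 \<Longrightarrow> I1 \<subseteq> J \<Longrightarrow> J \<times> I2 \<subseteq> \<Omega> \<Longrightarrow> J = I1"
    if "(I1, I2) \<in> G" for I1 I2
    using that F(2) by (auto simp: max_rectangles_1_def G_def)
  have "inj_on snd G"
  proof (rule inj_onI)
    fix R S assume RS: "R \<in> G" "S \<in> G" "snd R = snd S"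
    obtain I1 J1 I2 where eq: "R = (I1, I2)" "S = (J1, I2)" using RS(3) by (metis prod.collapse)
    have R: "(I1, I2) \<in> G" and S: "(J1, I2) \<in> G" using RS eq by auto
    have "I1 \<subseteq> J1 \<or> J1 \<subseteq> I1"
      using fst.nested[OF cubes(1)[OF R] cubes(1)[OF S]] x(1)[OF R] x(1)[OF S] by blast
    then have "I1 = J1"
      using maximal[OF R cubes(1)[OF S] _ cubes(3)[OF S]] maximal[OF S cubes(1)[OF R] _ cubes(3)[OF R]]
      by metis
    then show "R = S" using eq by simp
  qed
  then have "card G = card (snd ` G)" by (simp add: card_image)
  also have "\<dots> \<le> K2 * Suc j"
  proof (rule snd.card_chain_le[of _ "snd x"])
    show "finite (snd ` G)" using F(1) by (simp add: G_def)
    show "snd ` G \<subseteq> dyadic_cubes D2" using cubes(2) by force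
    show "snd x \<in> \<Inter>(snd ` G)" using x(3) by force
    fix I J assume "I \<in> snd ` G" "J \<in> snd ` G" "I \<subseteq> J"
    then obtain I1 J1 where IJ: "(I1, I) \<in> G" "(J1, J) \<in> G" by force
    show "measure M2 J < 2 ^ Suc j * measure M2 I"
    proof (rule ccontr)
      assume "\<not> ?thesis"
      then have "2 ^ Suc j * measure M2 I \<le> measure M2 J" by (simp only: not_less)
      then have "fst x \<in> persistent j I"
        unfolding persistent_def using cubes[OF IJ(2)] x(1)[OF IJ(2)] \<open>I \<subseteq> J\<close> by blast
      then show False using x(2)[OF IJ(1)] by blast
    qed
  qed
  finally show ?thesis by (simp only: G_def)
qed

text \<open>Replacing each rectangle by its non-persistent part costs the factor 2; these parts lie
  in \<Omega> and have bounded overlap.\<close>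

lemma sum_rectangles_at_scale:
  assumes F: "finite F" "F \<subseteq> \<R>"
    and large: "\<And>I1 I2. (I1, I2) \<in> F \<Longrightarrow> measure M2 (hat I1 I2) < 2 ^ Suc j * measure M2 I2"
  shows "(\<Sum>(I1, I2)\<in>F. measure M (I1 \<times> I2)) \<le> 2 * real (K2 * Suc j) * measure M \<Omega>"
proof -
  have cubes: "I1 \<in> sets M1" "I2 \<in> sets M2" "I1 \<times> I2 \<subseteq> \<Omega>" if "(I1, I2) \<in> F" for I1 I2
    using that F(2) fst.cube_sets snd.cube_sets by (auto simp: max_rectangles_1_def)
  let ?A = "\<lambda>R. (fst R - persistent j (snd R)) \<times> snd R"
  have "(\<Sum>(I1, I2)\<in>F. measure M (I1 \<times> I2)) \<le> (\<Sum>R\<in>F. 2 * measure M (?A R))"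
  proof (rule sum_mono, clarify)
    fix I1 I2 assume R: "(I1, I2) \<in> F"
    have "measure M1 I1 * measure M2 I2 \<le> 2 * measure M1 (I1 - persistent j I2) * measure M2 I2"
      using half_not_persistent[OF _ large[OF R]] R F(2) by (intro mult_right_mono) auto
    then show "measure M (I1 \<times> I2) \<le> 2 * measure M (?A (I1, I2))"
      using cubes[OF R] persistent_sets[of j I2] by (simp add: measure_Times)
  qed
  also have "\<dots> = 2 * (\<Sum>R\<in>F. measure M (?A R))" by (simp add: sum_distrib_left)
  also have "(\<Sum>R\<in>F. measure M (?A R)) \<le> real (K2 * Suc j) * measure M \<Omega>"
  proof (rule sum_measure_le_overlap[OF F(1) _ _ \<Omega>_sets finite_\<Omega> not_persistent_overlap[OF F]])
    fix R assume "R \<in> F"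
    then have "(fst R, snd R) \<in> F" by simp
    from cubes[OF this] show "?A R \<in> sets M" "?A R \<subseteq> \<Omega>" using persistent_sets[of j "snd R"] by auto
  qed
  finally show ?thesis by (simp only: mult.assoc mult_le_cancel_left_pos zero_less_numeral)
qed

lemma journe_1:
  assumes mono: "mono_on {0<..} w" and nonneg: "\<And>a. a > 0 \<Longrightarrow> w a \<ge> 0"
    and summable: "summable (\<lambda>j. real (Suc j) * w (1 / 2 ^ j))"
  defines "f \<equiv> \<lambda>(I1, I2). measure M (I1 \<times> I2) * w (measure M2 I2 / measure M2 (hat I1 I2))"
  shows "f summable_on \<R>"
    "infsum f \<R> \<le> 2 * real K2 * (\<Sum>j. real (Suc j) * w (1 / 2 ^ j)) * measure M \<Omega>"
proof -
  define q where "q R = measure M2 (snd R) / measure M2 (hat (fst R) (snd R))" for R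
  have f_eq: "f R = measure M (fst R \<times> snd R) * w (q R)" for R
    by (simp add: f_def q_def case_prod_beta)
  have q: "0 < q R" "q R \<le> 1" if "R \<in> \<R>" for R
  proof -
    obtain I1 I2 where R: "R = (I1, I2)" by (cases R)
    then have "I2 \<in> dyadic_cubes D2" using that by (auto simp: max_rectangles_1_def)
    with R that show "0 < q R" "q R \<le> 1"
      using snd.measure_cube_pos snd.measure_cube_mono hat_properties(1,2)[of I1 I2]
      by (auto simp: q_def)
  qed
  have f_nonneg: "0 \<le> f R" if "R \<in> \<R>" for R
    using nonneg[OF q(1)[OF that]] by (simp add: f_eq)
  \<comment> \<open>The two bounds on the ratio have different uses: the lower one limits the
    enlarged cube, as the estimate at scale \<open>j\<close> requires, and the upper one gives
    \<open>w (q R) \<le> w (1 / 2 ^ j)\<close> by monotonicity.\<close>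
  have "\<forall>R\<in>\<R>. \<exists>j. 1 / 2 ^ Suc j < q R \<and> q R \<le> 1 / 2 ^ j"
    using dyadic_scale q by metis
  from bchoice[OF this] obtain j where
    j: "\<forall>R\<in>\<R>. 1 / 2 ^ Suc (j R) < q R \<and> q R \<le> 1 / 2 ^ j R" by blast
  let ?C = "2 * real K2 * (\<Sum>j. real (Suc j) * w (1 / 2 ^ j)) * measure M \<Omega>"
  \<comment> \<open>As the terms are nonnegative, a common bound for all finite partial sums yields
    both summability and the bound for the infinite sum.\<close>
  have bound: "sum f F \<le> ?C" if F: "finite F" "F \<subseteq> \<R>" for F
  proof -
    have "sum f F \<le> (\<Sum>R\<in>F. w (1 / 2 ^ j R) * measure M (fst R \<times> snd R))"
    proof (rule sum_mono)
      fix R assume "R \<in> F"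
      then have R: "R \<in> \<R>" using F(2) by blast
      have "w (q R) \<le> w (1 / 2 ^ j R)"
        using q(1)[OF R] bspec[OF j R] by (intro mono_onD[OF mono]) simp_all
      then show "f R \<le> w (1 / 2 ^ j R) * measure M (fst R \<times> snd R)"
        by (simp add: f_eq mult.commute mult_right_mono)
    qed
    also have "\<dots> = (\<Sum>i\<in>j ` F. \<Sum>R\<in>{R\<in>F. j R = i}. w (1 / 2 ^ j R) * measure M (fst R \<times> snd R))"
      by (rule sum.image_gen[OF F(1), where g = j])
    also have "\<dots> = (\<Sum>i\<in>j ` F. w (1 / 2 ^ i) * (\<Sum>(I1, I2)\<in>{R\<in>F. j R = i}. measure M (I1 \<times> I2)))"
      unfolding sum_distrib_left case_prod_beta by (intro sum.cong refl) auto
    also have "\<dots> \<le> (\<Sum>i\<in>j ` F. w (1 / 2 ^ i) * (2 * real (K2 * Suc i) * measure M \<Omega>))"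
    proof (rule sum_mono)
      fix i
      have "(\<Sum>(I1, I2)\<in>{R\<in>F. j R = i}. measure M (I1 \<times> I2)) \<le> 2 * real (K2 * Suc i) * measure M \<Omega>"
      proof (rule sum_rectangles_at_scale)
        fix I1 I2 assume "(I1, I2) \<in> {R\<in>F. j R = i}"
        then have R: "(I1, I2) \<in> \<R>" "j (I1, I2) = i" using F(2) by auto
        then show "measure M2 (hat I1 I2) < 2 ^ Suc i * measure M2 I2"
          using bspec[OF j R(1)] snd.measure_cube_pos[OF hat_properties(1)[OF R(1)]]
          by (simp add: q_def field_simps)
      qed (use F in auto)
      then show "w (1 / 2 ^ i) * (\<Sum>(I1, I2)\<in>{R\<in>F. j R = i}. measure M (I1 \<times> I2)) \<le>
          w (1 / 2 ^ i) * (2 * real (K2 * Suc i) * measure M \<Omega>)"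
        by (rule mult_left_mono) (simp add: nonneg)
    qed
    also have "\<dots> = 2 * real K2 * (\<Sum>i\<in>j ` F. real (Suc i) * w (1 / 2 ^ i)) * measure M \<Omega>"
      unfolding sum_distrib_left sum_distrib_right of_nat_mult by (intro sum.cong refl) (simp only: mult_ac)
    also have "\<dots> \<le> ?C"
    proof (intro mult_right_mono mult_left_mono)
      show "(\<Sum>i\<in>j ` F. real (Suc i) * w (1 / 2 ^ i)) \<le> (\<Sum>i. real (Suc i) * w (1 / 2 ^ i))"
        using F(1) by (intro sum_le_suminf summable) (simp_all add: nonneg)
    qed simp_all
    finally show ?thesis .
  qed
  show sum: "f summable_on \<R>"
    using bound f_nonneg by (intro nonneg_bdd_above_summable_on bdd_aboveI2[where M = ?C]) auto
  show "infsum f \<R> \<le> ?C"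
    using bound by (rule infsum_le_finite_sums[OF sum])
qed

end

end


section \<open>The weight and the second factor\<close>

text \<open>If \<open>w a\<close> were negative, monotonicity would keep the terms of the series
  below \<open>w a\<close> from some index on, so they could not tend to zero.\<close>

lemma weight_nonneg:
  fixes w :: "real \<Rightarrow> real"
  assumes "C0 > 0" and mono: "mono_on {0<..} w"
    and summable: "summable (\<lambda>j::nat. real j * w (C0 * 2 powi (- int j)))" and "a > 0"
  shows "w a \<ge> 0"
proof (rule ccontr)
  assume "\<not> w a \<ge> 0"
  then have neg: "- w a > 0" by simp
  have "(\<lambda>j::nat. real j * w (C0 * 2 powi (- int j))) \<longlonglongrightarrow> 0"
    using summable by (rule summable_LIMSEQ_zero)
  from LIMSEQ_D[OF this neg] obtain n0 where
    n0: "\<And>j. j \<ge> n0 \<Longrightarrow> norm (real j * w (C0 * 2 powi (- int j)) - 0) < - w a" by blast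
  obtain n1 where "C0 / a < 2 ^ n1" using real_arch_pow[of 2] by auto
  then have n1: "C0 / 2 ^ n1 < a" using \<open>a > 0\<close> by (simp add: field_simps)
  \<comment> \<open>The successor makes \<open>j\<close> at least 1, so that the factor
    \<open>real j\<close> can only lower a negative value.\<close>
  define j where "j = Suc (max n0 n1)"
  have "C0 * 2 powi (- int j) = C0 / 2 ^ j" by (simp add: power_int_minus field_simps)
  also have "\<dots> \<le> C0 / 2 ^ n1"
    using \<open>C0 > 0\<close> by (intro divide_left_mono power_increasing) (auto simp: j_def)
  finally have "w (C0 * 2 powi (- int j)) \<le> w a"
    using n1 \<open>C0 > 0\<close> \<open>a > 0\<close> by (intro mono_onD[OF mono]) auto
  moreover from this have "real j * w (C0 * 2 powi (- int j)) \<le> 1 * w (C0 * 2 powi (- int j))"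
    using neg by (intro mult_right_mono_neg) (auto simp: j_def)
  moreover have "n0 \<le> j" by (simp add: j_def)
  from n0[OF this] have "\<bar>real j * w (C0 * 2 powi (- int j))\<bar> < - w a" by simp
  ultimately show False by linarith
qed

text \<open>The constant \<open>C0\<close> is absorbed by an index shift: if
  \<open>1 / C0 < 2 ^ m\<close>, then \<open>1 / 2 ^ (j + Suc m)\<close> is at most
  \<open>C0 / 2 ^ Suc j\<close>, and the linear factor grows at most by \<open>m + 2\<close>. The
  factor \<open>Suc j\<close> gives weight to class 0 as well.\<close>

lemma summable_weight:
  fixes w :: "real \<Rightarrow> real"
  assumes "C0 > 0" and mono: "mono_on {0<..} w"
    and summable: "summable (\<lambda>j::nat. real j * w (C0 * 2 powi (- int j)))"
  shows "summable (\<lambda>j. real (Suc j) * w (1 / 2 ^ j))"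
proof -
  note nonneg = weight_nonneg[OF assms]
  have powi: "C0 * 2 powi (- int j) = C0 / 2 ^ j" for j
    by (simp add: power_int_minus field_simps)
  obtain m where m: "1 / C0 < 2 ^ m" using real_arch_pow[of 2] by auto
  let ?f = "\<lambda>j. real (Suc j) * w (1 / 2 ^ j)"
  have "summable (\<lambda>j. real (m + 2) * (real (Suc j) * w (C0 / 2 ^ Suc j)))"
    using summable by (subst (asm) summable_Suc_iff[symmetric]) (simp only: powi summable_mult)
  then have "summable (\<lambda>j. ?f (j + Suc m))"
  proof (rule summable_comparison_test'[where N = 0])
    fix j
    have "1 / 2 ^ (j + Suc m) \<le> C0 / 2 ^ Suc j"
      using m \<open>C0 > 0\<close> by (simp add: power_add field_simps)
    then have le: "w (1 / 2 ^ (j + Suc m)) \<le> w (C0 / 2 ^ Suc j)"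
      using \<open>C0 > 0\<close> by (intro mono_onD[OF mono]) auto
    have "real (Suc (j + Suc m)) \<le> real (m + 2) * real (Suc j)" by (simp add: algebra_simps)
    then have "?f (j + Suc m) \<le> (real (m + 2) * real (Suc j)) * w (C0 / 2 ^ Suc j)"
      using le by (intro mult_mono nonneg) auto
    moreover have "0 \<le> ?f (j + Suc m)" by (simp add: nonneg)
    ultimately show "norm (?f (j + Suc m)) \<le> real (m + 2) * (real (Suc j) * w (C0 / 2 ^ Suc j))"
      by (simp only: real_norm_def abs_of_nonneg mult.assoc)
  qed
  then show ?thesis by (subst (asm) summable_iff_shift)
qed

section \<open>Exchange of the two factors\<close>

lemma max_rectangles_2_swap:
  "max_rectangles_2 D1 D2 \<Omega> = prod.swap ` max_rectangles_1 D2 D1 (prod.swap ` \<Omega>)"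
proof -
  have sub: "A \<times> B \<subseteq> prod.swap ` \<Omega> \<longleftrightarrow> B \<times> A \<subseteq> \<Omega>" for A B by force
  show ?thesis
    unfolding max_rectangles_1_def max_rectangles_2_def sub by (auto simp: image_iff)
qed

context dyadic_product
begin

lemma measure_swap:
  assumes "A \<in> sets (M1 \<Otimes>\<^sub>M M2)"
  shows "emeasure (M2 \<Otimes>\<^sub>M M1) (prod.swap ` A) = emeasure (M1 \<Otimes>\<^sub>M M2) A"
    and "measure (M2 \<Otimes>\<^sub>M M1) (prod.swap ` A) = measure (M1 \<Otimes>\<^sub>M M2) A"
proof -
  have "prod.swap ` A = (\<lambda>(x, y). (y, x)) -` A \<inter> space (M2 \<Otimes>\<^sub>M M1)"
    by (force simp: space_pair_measure fst.space_M snd.space_M)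
  then show "emeasure (M2 \<Otimes>\<^sub>M M1) (prod.swap ` A) = emeasure (M1 \<Otimes>\<^sub>M M2) A"
    using assms arg_cong[OF distr_pair_swap, of "\<lambda>N. emeasure N A"]
    by (simp add: emeasure_distr measurable_pair_swap')
  then show "measure (M2 \<Otimes>\<^sub>M M1) (prod.swap ` A) = measure (M1 \<Otimes>\<^sub>M M2) A"
    by (simp add: measure_def)
qed

text \<open>The swap preserves the product measure, so the two half-measure conditions select the
  same cubes.\<close>

lemma hat_1_swap:
  assumes \<Omega>: "open \<Omega>" and I2: "I2 \<in> dyadic_cubes D2"
  shows "hat_1 D1 (M1 \<Otimes>\<^sub>M M2) \<Omega> I1 I2 = hat_2 D1 (M2 \<Otimes>\<^sub>M M1) (prod.swap ` \<Omega>) I2 I1"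
proof -
  have "measure (M1 \<Otimes>\<^sub>M M2) (J \<times> I2) = measure (M2 \<Otimes>\<^sub>M M1) (I2 \<times> J) \<and>
      measure (M1 \<Otimes>\<^sub>M M2) ((J \<times> I2) \<inter> \<Omega>) = measure (M2 \<Otimes>\<^sub>M M1) ((I2 \<times> J) \<inter> prod.swap ` \<Omega>)"
    if J: "J \<in> dyadic_cubes D1" for J
  proof -
    have meas: "J \<times> I2 \<in> sets (M1 \<Otimes>\<^sub>M M2)" "(J \<times> I2) \<inter> \<Omega> \<in> sets (M1 \<Otimes>\<^sub>M M2)"
      using fst.cube_sets[OF J] snd.cube_sets[OF I2] sets_open[OF \<Omega>] by auto
    have "prod.swap ` (J \<times> I2) = I2 \<times> J" "prod.swap ` ((J \<times> I2) \<inter> \<Omega>) = (I2 \<times> J) \<inter> prod.swap ` \<Omega>"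
      by force+
    with measure_swap(2)[OF meas(1)] measure_swap(2)[OF meas(2)] show ?thesis by simp
  qed
  then show ?thesis
    unfolding hat_1_def hat_2_def by (intro arg_cong[where f = Greatest] ext) auto
qed

text \<open>The coordinate swap turns this into the first estimate for the product in reverse order,
  so the chain constant is now that of the first factor.\<close>

lemma journe_2:
  assumes \<Omega>: "open \<Omega>" "emeasure (M1 \<Otimes>\<^sub>M M2) \<Omega> < \<infinity>"
    and w: "mono_on {0<..} w" "\<And>a. a > 0 \<Longrightarrow> w a \<ge> 0"
      "summable (\<lambda>j. real (Suc j) * w (1 / 2 ^ j))"
  defines "f \<equiv> \<lambda>(I1, I2). measure (M1 \<Otimes>\<^sub>M M2) (I1 \<times> I2) *
      w (measure M1 I1 / measure M1 (hat_1 D1 (M1 \<Otimes>\<^sub>M M2) \<Omega> I1 I2))"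
  shows "f summable_on max_rectangles_2 D1 D2 \<Omega>"
    "infsum f (max_rectangles_2 D1 D2 \<Omega>) \<le>
       2 * real K1 * (\<Sum>j. real (Suc j) * w (1 / 2 ^ j)) * measure (M1 \<Otimes>\<^sub>M M2) \<Omega>"
proof -
  interpret swapped: dyadic_product M2 D2 K2 M1 D1 K1 ..
  let ?\<Omega> = "prod.swap ` \<Omega>"
  let ?R = "max_rectangles_1 D2 D1 ?\<Omega>"
  let ?g = "\<lambda>(I2, I1). measure (M2 \<Otimes>\<^sub>M M1) (I2 \<times> I1) *
      w (measure M1 I1 / measure M1 (hat_2 D1 (M2 \<Otimes>\<^sub>M M1) ?\<Omega> I2 I1))"
  have "?\<Omega> = prod.swap -` \<Omega>" by force
  then have open': "open ?\<Omega>"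
    using open_vimage[OF \<Omega>(1), of prod.swap] by (simp add: continuous_on_swap)
  have finite': "emeasure (M2 \<Otimes>\<^sub>M M1) ?\<Omega> < \<infinity>"
    using measure_swap(1)[OF sets_open[OF \<Omega>(1)]] \<Omega>(2) by simp
  have eq: "(f \<circ> prod.swap) R = ?g R" if "R \<in> ?R" for R
  proof -
    obtain I1 I2 where R: "R = (I2, I1)" by (cases R)
    with that have I: "I1 \<in> dyadic_cubes D1" "I2 \<in> dyadic_cubes D2" by (auto simp: max_rectangles_1_def)
    then show ?thesis
      using fst.cube_sets[OF I(1)] snd.cube_sets[OF I(2)] hat_1_swap[OF \<Omega>(1) I(2), of I1]
      by (simp add: R f_def measure_Times swapped.measure_Times mult.commute)
  qed
  note journe = swapped.journe_1[OF open' finite' w]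
  have "f summable_on (prod.swap ` ?R) \<longleftrightarrow> (f \<circ> prod.swap) summable_on ?R"
    by (intro summable_on_reindex) auto
  also have "\<dots> \<longleftrightarrow> ?g summable_on ?R" using eq by (intro summable_on_cong)
  finally show "f summable_on max_rectangles_2 D1 D2 \<Omega>"
    using journe(1) by (simp only: max_rectangles_2_swap)
  have "infsum f (prod.swap ` ?R) = infsum (f \<circ> prod.swap) ?R" by (intro infsum_reindex) auto
  also have "\<dots> = infsum ?g ?R" using eq by (intro infsum_cong)
  finally show "infsum f (max_rectangles_2 D1 D2 \<Omega>) \<le>
       2 * real K1 * (\<Sum>j. real (Suc j) * w (1 / 2 ^ j)) * measure (M1 \<Otimes>\<^sub>M M2) \<Omega>"
    using journe(2) measure_swap(2)[OF sets_open[OF \<Omega>(1)]] by (simp only: max_rectangles_2_swap)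
qed

end

section \<open>Application to Carnot-Caratheodory spaces\<close>

lemma carnot_caratheodory_dyadic_system:
  assumes "carnot_caratheodory_space \<A> Xs \<mu>" "christ_cubes (control_metric \<A> Xs) \<mu> D"
  obtains K where "dyadic_system \<mu> D K"
proof (rule christ_cubes_dyadic_system[OF assms(2)])
  show "doubling (control_metric \<A> Xs) \<mu>"
    using assms(1) unfolding carnot_caratheodory_space_def by (elim conjE)
  show "sets \<mu> = sets borel"
    using assms(1)
    unfolding carnot_caratheodory_space_def smooth_positive_measure_def lebesgue_in_global_chart_def
    by (elim conjE disjE)
qed

theorem lemma3p3:
  fixes \<A>\<^sub>1 :: "('a::{t2_space,second_countable_topology}, 'e::euclidean_space) chart set"
    and \<A>\<^sub>2 :: "('b::{t2_space,second_countable_topology}, 'f::euclidean_space) chart set"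
    and Xs\<^sub>1 :: "'a vector_field list" and Xs\<^sub>2 :: "'b vector_field list"
    and \<mu>\<^sub>1 :: "'a measure" and \<mu>\<^sub>2 :: "'b measure"
    and D\<^sub>1 :: "int \<Rightarrow> 'a set set" and D\<^sub>2 :: "int \<Rightarrow> 'b set set"
    and w :: "real \<Rightarrow> real" and C\<^sub>0 :: real
  defines "\<mu> \<equiv> \<mu>\<^sub>1 \<Otimes>\<^sub>M \<mu>\<^sub>2"
  assumes "carnot_caratheodory_space \<A>\<^sub>1 Xs\<^sub>1 \<mu>\<^sub>1"
    and "carnot_caratheodory_space \<A>\<^sub>2 Xs\<^sub>2 \<mu>\<^sub>2"
    and "christ_cubes (control_metric \<A>\<^sub>1 Xs\<^sub>1) \<mu>\<^sub>1 D\<^sub>1"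
    and "christ_cubes (control_metric \<A>\<^sub>2 Xs\<^sub>2) \<mu>\<^sub>2 D\<^sub>2"
    and "C\<^sub>0 > 0"
    and "mono_on {0<..} w"
    and "summable (\<lambda>j::nat. real j * w (C\<^sub>0 * 2 powi (- int j)))"
  shows "\<exists>C>0. \<forall>\<Omega>. open \<Omega> \<and> emeasure \<mu> \<Omega> < \<infinity> \<longrightarrow>
    ((\<lambda>(I\<^sub>1, I\<^sub>2). measure \<mu> (I\<^sub>1 \<times> I\<^sub>2) * w (measure \<mu>\<^sub>2 I\<^sub>2 / measure \<mu>\<^sub>2 (hat_2 D\<^sub>2 \<mu> \<Omega> I\<^sub>1 I\<^sub>2)))
       summable_on max_rectangles_1 D\<^sub>1 D\<^sub>2 \<Omega> \<and>
     (\<Sum>\<^sub>\<infinity>(I\<^sub>1, I\<^sub>2)\<in>max_rectangles_1 D\<^sub>1 D\<^sub>2 \<Omega>.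
        measure \<mu> (I\<^sub>1 \<times> I\<^sub>2) * w (measure \<mu>\<^sub>2 I\<^sub>2 / measure \<mu>\<^sub>2 (hat_2 D\<^sub>2 \<mu> \<Omega> I\<^sub>1 I\<^sub>2)))
       \<le> C * measure \<mu> \<Omega>) \<and>
    ((\<lambda>(I\<^sub>1, I\<^sub>2). measure \<mu> (I\<^sub>1 \<times> I\<^sub>2) * w (measure \<mu>\<^sub>1 I\<^sub>1 / measure \<mu>\<^sub>1 (hat_1 D\<^sub>1 \<mu> \<Omega> I\<^sub>1 I\<^sub>2)))
       summable_on max_rectangles_2 D\<^sub>1 D\<^sub>2 \<Omega> \<and>
     (\<Sum>\<^sub>\<infinity>(I\<^sub>1, I\<^sub>2)\<in>max_rectangles_2 D\<^sub>1 D\<^sub>2 \<Omega>.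
        measure \<mu> (I\<^sub>1 \<times> I\<^sub>2) * w (measure \<mu>\<^sub>1 I\<^sub>1 / measure \<mu>\<^sub>1 (hat_1 D\<^sub>1 \<mu> \<Omega> I\<^sub>1 I\<^sub>2)))
       \<le> C * measure \<mu> \<Omega>)"
proof -
  obtain K\<^sub>1 where K1: "dyadic_system \<mu>\<^sub>1 D\<^sub>1 K\<^sub>1"
    using assms(2,4) by (rule carnot_caratheodory_dyadic_system)
  obtain K\<^sub>2 where K2: "dyadic_system \<mu>\<^sub>2 D\<^sub>2 K\<^sub>2"
    using assms(3,5) by (rule carnot_caratheodory_dyadic_system)
  interpret dyadic_product \<mu>\<^sub>1 D\<^sub>1 K\<^sub>1 \<mu>\<^sub>2 D\<^sub>2 K\<^sub>2
    using K1 K2 by (rule dyadic_product.intro)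
  note nonneg = weight_nonneg[OF assms(6,7,8)]
  note summable = summable_weight[OF assms(6,7,8)]
  define S where "S = (\<Sum>j. real (Suc j) * w (1 / 2 ^ j))"
  have S: "S \<ge> 0" unfolding S_def by (intro suminf_nonneg summable mult_nonneg_nonneg nonneg) auto
  \<comment> \<open>One constant serves both sums; the summand 1 keeps it positive even if the other
    two vanish.\<close>
  define C where "C = 2 * real K\<^sub>1 * S + 2 * real K\<^sub>2 * S + 1"
  have C: "C > 0" "2 * real K\<^sub>1 * S \<le> C" "2 * real K\<^sub>2 * S \<le> C"
    using S by (auto simp: C_def intro: add_nonneg_pos)
  show ?thesis
  proof (intro exI[of _ C] conjI allI impI; (elim conjE)?)
    show "C > 0" by (rule C)
    fix \<Omega> :: "('a \<times> 'b) set"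
    assume \<Omega>: "open \<Omega>" "emeasure \<mu> \<Omega> < \<infinity>"
    note j1 = journe_1[OF \<Omega>[unfolded \<mu>_def] assms(7) nonneg summable, folded S_def \<mu>_def]
    note j2 = journe_2[OF \<Omega>[unfolded \<mu>_def] assms(7) nonneg summable, folded S_def \<mu>_def]
    have scale: "2 * real K * S * measure \<mu> \<Omega> \<le> C * measure \<mu> \<Omega>" if "2 * real K * S \<le> C" for K
      using that by (rule mult_right_mono) simp
    show "(\<lambda>(I\<^sub>1, I\<^sub>2). measure \<mu> (I\<^sub>1 \<times> I\<^sub>2) * w (measure \<mu>\<^sub>2 I\<^sub>2 / measure \<mu>\<^sub>2 (hat_2 D\<^sub>2 \<mu> \<Omega> I\<^sub>1 I\<^sub>2)))
       summable_on max_rectangles_1 D\<^sub>1 D\<^sub>2 \<Omega>" by (rule j1(1))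
    show "(\<Sum>\<^sub>\<infinity>(I\<^sub>1, I\<^sub>2)\<in>max_rectangles_1 D\<^sub>1 D\<^sub>2 \<Omega>.
        measure \<mu> (I\<^sub>1 \<times> I\<^sub>2) * w (measure \<mu>\<^sub>2 I\<^sub>2 / measure \<mu>\<^sub>2 (hat_2 D\<^sub>2 \<mu> \<Omega> I\<^sub>1 I\<^sub>2)))
       \<le> C * measure \<mu> \<Omega>" using j1(2) scale[OF C(3)] by (rule order_trans)
    show "(\<lambda>(I\<^sub>1, I\<^sub>2). measure \<mu> (I\<^sub>1 \<times> I\<^sub>2) * w (measure \<mu>\<^sub>1 I\<^sub>1 / measure \<mu>\<^sub>1 (hat_1 D\<^sub>1 \<mu> \<Omega> I\<^sub>1 I\<^sub>2)))
       summable_on max_rectangles_2 D\<^sub>1 D\<^sub>2 \<Omega>" by (rule j2(1))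
    show "(\<Sum>\<^sub>\<infinity>(I\<^sub>1, I\<^sub>2)\<in>max_rectangles_2 D\<^sub>1 D\<^sub>2 \<Omega>.
        measure \<mu> (I\<^sub>1 \<times> I\<^sub>2) * w (measure \<mu>\<^sub>1 I\<^sub>1 / measure \<mu>\<^sub>1 (hat_1 D\<^sub>1 \<mu> \<Omega> I\<^sub>1 I\<^sub>2)))
       \<le> C * measure \<mu> \<Omega>" using j2(2) scale[OF C(2)] by (rule order_trans)
  qed
qed

end
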